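(* Let $\nu=\nu_Z$ be the measure defined in the context from a stochastic representer $Z$, let $X\in\mathrm{RV}_\Pi(\alpha,\nu;b)$, and let $H:\mathcal C\to\mathbb R^q$ be Borel measurable and continuous $\nu$-almost everywhere, with $$H(r\odot f)=r\odot H(f),\qquad r\in G,\ f\in\mathcal C.$$ Assume that $A_H=\{f\in\mathcal C:|H_i(f)|>1,\ 1\le i\le q\}\in\mathcal B_\Pi$ and $p_H=\nu(A_H)>0$. Then on $(\mathbb R\setminus\{0\})^q$ $$H(X)\in\mathrm{RV}_\Pi(\alpha,\nu_H;b),\qquad \nu_H=(H_\#\nu)|_{(\mathbb R\setminus\{0\})^q}.$$ If moreover $H$ takes values in $[0,\infty)^q$, then $p_H=\mathbb E\{\prod_{i=1}^qH_i(Z)^{\alpha_i}\}$ and, for every $x\in G$, $$\lim_{u\to\infty}a(u)\,\mathbb P\{H_i(X)>u_ix_i,\ 1\le i\le q\}=p_H\prod_{i=1}^qx_i^{-\alpha_i}.$$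
   Context: Index set and paths. $q\in\mathbb N=\{1,2,\dots\}$; $\mathsf T$ is either a nonempty finite or countably infinite discrete set, or $\mathsf T=\mathbb R^m$ with $m\in\mathbb N$. $\mathcal C=C(\mathsf T,\mathbb R^q)$ is the space of continuous functions $f=(f_1,\dots,f_q)$ with the topology of locally uniform convergence and its Borel $\sigma$-field. $(K_n)_{n\ge1}$ is a fixed increasing exhaustion of $\mathsf T$ by nonempty compact sets such that every compact subset lies in some $K_n$; for $\mathsf T=\mathbb R^m$, $K_n=[-n,n]^m$. Put $\rho_{n,i}(f)=\sup_{t\in K_n}|f_i(t)|$. Scaling. $G=(0,\infty)^q$, $(r\odot f)(t)=(r_1f_1(t),\dots,r_qf_q(t))$ for $r\in G$, and likewise $r\odot x=(r_1x_1,\dots,r_qx_q)$ for $x\in\mathbb R^q$; $u^{-1}=(u_1^{-1},\dots,u_q^{-1})$. Fix $\alpha\in(0,\infty)^q$ and put $\vartheta_\alpha(dr)=\prod_{i=1}^q\alpha_ir_i^{-\alpha_i-1}dr_i$ on $G$. Localisation. $\mathcal C_\Pi^\circ=\{f\in\mathcal C:f_i\not\equiv0\text{ for all }i\}$; product windows $U_{\boldsymbol n,\varepsilon}=\{f\in\mathcal C:\rho_{n_i,i}(f)>\varepsilon_i,\ 1\le i\le q\}$, $\boldsymbol n\in\mathbb N^q,\varepsilon\in G$. $\mathcal B_\Pi$ is the collection of Borel subsets of $\mathcal C_\Pi^\circ$ contained in some product window; a measure on $\mathcal C_\Pi^\circ$ is boundedly finite if it is finite on every product window. $C_\Pi(\mathcal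 C)$ is the set of bounded continuous $F:\mathcal C\to\mathbb R$ vanishing outside some product window. Target. $Z$ is a $\mathcal C_\Pi^\circ$-valued random element with $\mathbb E\{\prod_i\rho_{n_i,i}(Z)^{\alpha_i}\}<\infty$ for all $\boldsymbol n\in\mathbb N^q$, and $\nu=\nu_Z$, $\nu_Z(A)=\mathbb E\{\int_G\mathbb I_{\{r\odot Z\in A\}}\vartheta_\alpha(dr)\}$. Thresholds and rates. $u\to\infty$ ($u\in G$) means $\min_iu_i\to\infty$, with no restriction on relative rates (limits along every such sequence). $b=(b_1,\dots,b_q)$, $b_i:(0,\infty)\to(0,\infty)$ regularly varying at infinity with index $\alpha_i$; $a(u)=\prod_ib_i(u_i)$. For a $\mathcal C$-valued random field $X$, $X\in\mathrm{RV}_\Pi(\alpha,\nu;b)$ means that $\nu$ is nonzero and boundedly finite and $\lim_{u\to\infty}a(u)\mathbb E\{F(u^{-1}\odot X)\}=\int F\,d\nu$ for all $F\in C_\Pi(\mathcal C)$. On $\mathbb R^q$, bounded sets are the Borel sets contained in $\{x:\min_i|x_i|>\varepsilon\}$ for some $\varepsilon>0$, and test functions are the bounded continuous $F:\mathbb R^q\to\mathbb R$ vanishing whenever $\min_i|x_i|\le\varepsilon$, for some $\varepsilon>0$. Accordingly, for an $\mathbb R^q$-valued random vector $Y$, $Y\in\mathrm{RV}_\Pi(\alpha,\eta;b)$ on $(\mathbb R\setminus\{0\})^q$ means that $\eta$ is a nonzero measure on $(\mathbb R\setminus\{0\})^q$, finite on these bounded sets, with $\lim_{u\to\infty}a(u)\mathbb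 E\{F(u^{-1}\odot Y)\}=\int F\,d\eta$ for all such test functions. $H_\#\nu=\nu\circ H^{-1}$. *)

theory Defs
  imports "HOL-Probability.Probability"
begin

text \<open>
  The index set T is the whole type \<open>'t\<close>.  \<open>index_exhaustion K\<close> says that it is either a countable
  (finite or infinite, nonempty since types are) discrete space, or a copy of R^m, and that
  \<open>K n\<close>, n \<ge> 1, is an admissible exhaustion.  The dimension m is a number here, so the second case
  refers to \<open>Euclidean_space m\<close> through a homeomorphism h, which also carries the cubes [-n,n]^m.
  The value \<open>K 0\<close> plays no role.
\<close>

definition compact_exhaustion :: "(nat \<Rightarrow> 't::topological_space set) \<Rightarrow> bool" where
  "compact_exhaustion K \<longleftrightarrow>
     (\<forall>n\<ge>1. K n \<noteq> {} \<and> compact (K n) \<and> K n \<subseteq> K (Suc n)) \<and>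
     (\<Union>n\<in>{1..}. K n) = UNIV \<and>
     (\<forall>L. compact L \<longrightarrow> (\<exists>n\<ge>1. L \<subseteq> K n))"

definition index_exhaustion :: "(nat \<Rightarrow> 't::topological_space set) \<Rightarrow> bool" where
  "index_exhaustion K \<longleftrightarrow>
     (countable (UNIV :: 't set) \<and> (\<forall>S :: 't set. open S) \<and> compact_exhaustion K) \<or>
     (\<exists>m\<ge>1. \<exists>h :: (nat \<Rightarrow> real) \<Rightarrow> 't. homeomorphic_map (Euclidean_space m) euclidean h \<and>
        (\<forall>n\<ge>1. K n = h ` {x \<in> topspace (Euclidean_space m). \<forall>j<m. \<bar>x j\<bar> \<le> real n}))"

definition CT :: "('t::topological_space \<Rightarrow> real ^ 'q) set" where
  "CT = {f. continuous_on UNIV f}"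

text \<open>
  Locally uniform convergence is uniform convergence on compact sets, as the index set is locally
  compact.
\<close>

definition lu_open :: "('t::topological_space \<Rightarrow> real ^ 'q) set \<Rightarrow> bool" where
  "lu_open U \<longleftrightarrow> U \<subseteq> CT \<and>
     (\<forall>f\<in>U. \<exists>L e. compact L \<and> e > 0 \<and>
        (\<forall>g\<in>CT. (\<forall>t\<in>L. dist (g t) (f t) < e) \<longrightarrow> g \<in> U))"

definition lu_topology :: "('t::topological_space \<Rightarrow> real ^ 'q) topology" where
  "lu_topology = topology lu_open"

lemma istopology_lu_open:
  "istopology (lu_open :: ('t::topological_space \<Rightarrow> real ^ 'q) set \<Rightarrow> bool)"
  unfolding istopology_def
proof (intro conjI allI impI)
  fix S T :: "('t \<Rightarrow> real ^ 'q) set"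
  assume S: "lu_open S" and T: "lu_open T"
  show "lu_open (S \<inter> T)"
    unfolding lu_open_def
  proof (intro conjI ballI)
    show "S \<inter> T \<subseteq> CT" using S by (auto simp: lu_open_def)
  next
    fix f assume f: "f \<in> S \<inter> T"
    obtain L1 e1 where 1: "compact L1" "e1 > 0"
      "\<And>g. g \<in> CT \<Longrightarrow> (\<forall>t\<in>L1. dist (g t) (f t) < e1) \<Longrightarrow> g \<in> S"
      using S f unfolding lu_open_def by (metis IntD1)
    obtain L2 e2 where 2: "compact L2" "e2 > 0"
      "\<And>g. g \<in> CT \<Longrightarrow> (\<forall>t\<in>L2. dist (g t) (f t) < e2) \<Longrightarrow> g \<in> T"
      using T f unfolding lu_open_def by (metis IntD2)
    show "\<exists>L e. compact L \<and> e > 0 \<and>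
        (\<forall>g\<in>CT. (\<forall>t\<in>L. dist (g t) (f t) < e) \<longrightarrow> g \<in> S \<inter> T)"
      by (rule exI[of _ "L1 \<union> L2"], rule exI[of _ "min e1 e2"])
        (use 1 2 in \<open>auto simp: compact_Un\<close>)
  qed
next
  fix \<K> :: "('t \<Rightarrow> real ^ 'q) set set"
  assume *: "\<forall>S\<in>\<K>. lu_open S"
  show "lu_open (\<Union>\<K>)"
    unfolding lu_open_def
  proof (intro conjI ballI)
    show "\<Union>\<K> \<subseteq> CT" using * by (auto simp: lu_open_def)
  next
    fix f assume "f \<in> \<Union>\<K>"
    then obtain S where S: "S \<in> \<K>" "f \<in> S" by blast
    then obtain L e where "compact L" "e > 0"
      "\<forall>g\<in>CT. (\<forall>t\<in>L. dist (g t) (f t) < e) \<longrightarrow> g \<in> S"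
      using * unfolding lu_open_def by meson
    with S show "\<exists>L e. compact L \<and> e > 0 \<and>
        (\<forall>g\<in>CT. (\<forall>t\<in>L. dist (g t) (f t) < e) \<longrightarrow> g \<in> \<Union>\<K>)"
      by (metis UnionI)
  qed
qed

lemma openin_lu_topology: "openin lu_topology U \<longleftrightarrow> lu_open U"
  by (simp add: lu_topology_def topology_inverse' istopology_lu_open)

lemma topspace_lu_topology: "topspace lu_topology = CT"
proof
  show "topspace lu_topology \<subseteq> CT"
    by (auto simp: topspace_def openin_lu_topology lu_open_def)
  have "lu_open CT"
    unfolding lu_open_def by (auto intro!: exI[of _ "{}"] exI[of _ 1])
  then show "CT \<subseteq> topspace lu_topology"
    by (auto simp: topspace_def openin_lu_topology)
qed

definition borel_CT :: "('t::topological_space \<Rightarrow> real ^ 'q) measure" where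
  "borel_CT = sigma CT {U. openin lu_topology U}"

definition rho :: "(nat \<Rightarrow> 't set) \<Rightarrow> nat \<Rightarrow> 'q \<Rightarrow> ('t \<Rightarrow> real ^ 'q) \<Rightarrow> real" where
  "rho K n i f = (SUP t\<in>K n. \<bar>f t $ i\<bar>)"

definition pos_vecs :: "(real ^ 'q) set" where
  "pos_vecs = {r. \<forall>i. 0 < r $ i}"

definition vinv :: "real ^ 'q \<Rightarrow> real ^ 'q" where
  "vinv u = (\<chi> i. inverse (u $ i))"

text \<open>Multiplication on \<open>real ^ 'q\<close> is componentwise, so \<open>r * x\<close> is the action on vectors.\<close>

definition scale_fun :: "real ^ 'q \<Rightarrow> ('t \<Rightarrow> real ^ 'q) \<Rightarrow> ('t \<Rightarrow> real ^ 'q)" (infixr "\<odot>" 75) where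
  "r \<odot> f = (\<lambda>t. r * f t)"

text \<open>The measure on G, regarded as a measure on the whole space concentrated on G.\<close>

definition theta :: "real ^ 'q \<Rightarrow> (real ^ 'q) measure" where
  "theta \<alpha> = density lborel
     (\<lambda>r. ennreal (\<Prod>i\<in>UNIV. \<alpha> $ i * (r $ i) powr (- (\<alpha> $ i) - 1)) * indicator pos_vecs r)"

definition CPi :: "('t::topological_space \<Rightarrow> real ^ 'q) set" where
  "CPi = {f \<in> CT. \<forall>i. \<exists>t. f t $ i \<noteq> 0}"

text \<open>\<open>CPi\<close> is open, so these are exactly the Borel subsets of \<open>CT\<close> contained in \<open>CPi\<close>.\<close>

definition borel_CPi :: "('t::topological_space \<Rightarrow> real ^ 'q) measure" where
  "borel_CPi = restrict_space borel_CT CPi"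

definition window ::
  "(nat \<Rightarrow> 't::topological_space set) \<Rightarrow> ('q \<Rightarrow> nat) \<Rightarrow> real ^ 'q \<Rightarrow> ('t \<Rightarrow> real ^ 'q) set" where
  "window K n \<epsilon> = {f \<in> CT. \<forall>i. rho K (n i) i f > \<epsilon> $ i}"

definition BPi :: "(nat \<Rightarrow> 't::topological_space set) \<Rightarrow> ('t \<Rightarrow> real ^ 'q) set set" where
  "BPi K = {A \<in> sets borel_CPi. \<exists>n \<epsilon>. (\<forall>i. n i \<ge> 1) \<and> \<epsilon> \<in> pos_vecs \<and> A \<subseteq> window K n \<epsilon>}"

definition test_CPi :: "(nat \<Rightarrow> 't::topological_space set) \<Rightarrow> (('t \<Rightarrow> real ^ 'q) \<Rightarrow> real) set" where
  "test_CPi K = {F. continuous_map lu_topology euclideanreal F \<and> bounded (F ` CT) \<and>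
     (\<exists>n \<epsilon>. (\<forall>i. n i \<ge> 1) \<and> \<epsilon> \<in> pos_vecs \<and> (\<forall>f \<in> CT - window K n \<epsilon>. F f = 0))}"

definition representer ::
  "(nat \<Rightarrow> 't::topological_space set) \<Rightarrow> real ^ 'q \<Rightarrow> 'z measure \<Rightarrow> ('z \<Rightarrow> 't \<Rightarrow> real ^ 'q) \<Rightarrow> bool" where
  "representer K \<alpha> N Z \<longleftrightarrow> Z \<in> N \<rightarrow>\<^sub>M borel_CPi \<and>
     (\<forall>n. (\<forall>i. n i \<ge> 1) \<longrightarrow>
        (\<integral>\<^sup>+ w. ennreal (\<Prod>i\<in>UNIV. rho K (n i) i (Z w) powr (\<alpha> $ i)) \<partial>N) < \<infinity>)"

definition nu_of ::
  "real ^ 'q \<Rightarrow> 'z measure \<Rightarrow> ('z \<Rightarrow> 't::topological_space \<Rightarrow> real ^ 'q) \<Rightarrow> ('t \<Rightarrow> real ^ 'q) measure" where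
  "nu_of \<alpha> N Z = measure_of CPi (sets borel_CPi)
     (\<lambda>A. \<integral>\<^sup>+ w. (\<integral>\<^sup>+ r. indicator A (r \<odot> Z w) \<partial>theta \<alpha>) \<partial>N)"

definition to_infty :: "(real ^ 'q) filter" where
  "to_infty = filtercomap (\<lambda>u. Min (range (\<lambda>i. u $ i))) at_top"

definition regularly_varying :: "(real \<Rightarrow> real) \<Rightarrow> real \<Rightarrow> bool" where
  "regularly_varying g \<kappa> \<longleftrightarrow> g \<in> borel_measurable (restrict_space borel {0<..}) \<and>
     (\<forall>x>0. g x > 0) \<and> (\<forall>x>0. ((\<lambda>s. g (x * s) / g s) \<longlongrightarrow> x powr \<kappa>) at_top)"

definition rate :: "('q::finite \<Rightarrow> real \<Rightarrow> real) \<Rightarrow> real ^ 'q \<Rightarrow> real" where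
  "rate b u = (\<Prod>i\<in>UNIV. b i (u $ i))"

definition RV_CT ::
  "(nat \<Rightarrow> 't::topological_space set) \<Rightarrow> real ^ 'q \<Rightarrow> ('t \<Rightarrow> real ^ 'q) measure \<Rightarrow>
   ('q \<Rightarrow> real \<Rightarrow> real) \<Rightarrow> 'a measure \<Rightarrow> ('a \<Rightarrow> 't \<Rightarrow> real ^ 'q) \<Rightarrow> bool" where
  "RV_CT K \<alpha> \<nu> b M X \<longleftrightarrow>
     (\<forall>i. regularly_varying (b i) (\<alpha> $ i)) \<and>
     X \<in> M \<rightarrow>\<^sub>M borel_CT \<and>
     space \<nu> = CPi \<and> sets \<nu> = sets borel_CPi \<and>
     emeasure \<nu> CPi \<noteq> 0 \<and>
     (\<forall>n \<epsilon>. (\<forall>i. n i \<ge> 1) \<and> \<epsilon> \<in> pos_vecs \<longrightarrow> emeasure \<nu> (window K n \<epsilon>) < \<infinity>) \<and>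
     (\<forall>F\<in>test_CPi K.
        ((\<lambda>u. rate b u * (\<integral>w. F (vinv u \<odot> X w) \<partial>M)) \<longlongrightarrow> (\<integral>f. F f \<partial>\<nu>)) to_infty)"

definition nonzero_vecs :: "(real ^ 'q) set" where
  "nonzero_vecs = {x. \<forall>i. x $ i \<noteq> 0}"

definition vec_bounded_sets :: "(real ^ 'q) set set" where
  "vec_bounded_sets =
     {B \<in> sets borel. \<exists>\<epsilon>>0. B \<subseteq> {x. Min (range (\<lambda>i. \<bar>x $ i\<bar>)) > \<epsilon>}}"

definition vec_test :: "(real ^ 'q \<Rightarrow> real) set" where
  "vec_test = {F. continuous_on UNIV F \<and> bounded (range F) \<and>
     (\<exists>\<epsilon>>0. \<forall>x. Min (range (\<lambda>i. \<bar>x $ i\<bar>)) \<le> \<epsilon> \<longrightarrow> F x = 0)}"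

definition RV_vec ::
  "real ^ 'q \<Rightarrow> (real ^ 'q) measure \<Rightarrow> ('q \<Rightarrow> real \<Rightarrow> real) \<Rightarrow> 'a measure \<Rightarrow>
   ('a \<Rightarrow> real ^ 'q) \<Rightarrow> bool" where
  "RV_vec \<alpha> \<eta> b M Y \<longleftrightarrow>
     (\<forall>i. regularly_varying (b i) (\<alpha> $ i)) \<and>
     Y \<in> M \<rightarrow>\<^sub>M borel \<and>
     space \<eta> = nonzero_vecs \<and> sets \<eta> = sets (restrict_space borel nonzero_vecs) \<and>
     emeasure \<eta> nonzero_vecs \<noteq> 0 \<and>
     (\<forall>B\<in>vec_bounded_sets. emeasure \<eta> B < \<infinity>) \<and>
     (\<forall>F\<in>vec_test.
        ((\<lambda>u. rate b u * (\<integral>w. F (vinv u * Y w) \<partial>M)) \<longlongrightarrow> (\<integral>x. F x \<partial>\<eta>)) to_infty)"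

text \<open>Continuity at a single point; \<open>atin\<close> is the punctured neighbourhood filter.\<close>

definition continuous_at_CT ::
  "(('t::topological_space \<Rightarrow> real ^ 'q) \<Rightarrow> real ^ 'q) \<Rightarrow> ('t \<Rightarrow> real ^ 'q) \<Rightarrow> bool" where
  "continuous_at_CT H f \<longleftrightarrow> (H \<longlongrightarrow> H f) (atin lu_topology f)"

definition exceedance_set ::
  "(('t::topological_space \<Rightarrow> real ^ 'q) \<Rightarrow> real ^ 'q) \<Rightarrow> ('t \<Rightarrow> real ^ 'q) set" where
  "exceedance_set H = {f \<in> CT. \<forall>i. \<bar>H f $ i\<bar> > 1}"

definition pushforward_nz ::
  "(('t::topological_space \<Rightarrow> real ^ 'q) \<Rightarrow> real ^ 'q) \<Rightarrow> ('t \<Rightarrow> real ^ 'q) measure \<Rightarrow> (real ^ 'q) measure" where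
  "pushforward_nz H \<nu> = restrict_space (distr \<nu> borel H) nonzero_vecs"

end

theory Submission
  imports Defs
begin

text \<open>
  If \<open>G\<close> is bounded and vanishes near the coordinate hyperplanes, then by homogeneity \<open>G \<circ> H\<close> vanishes
  outside a rescaled copy of the exceedance set, hence outside a product window, and homogeneity also
  turns \<open>H (u\<^sup>-\<^sup>1 \<odot> X)\<close> into \<open>u\<^sup>-\<^sup>1 * H X\<close>.  So everything reduces to extending the defining limit of
  \<open>RV_CT\<close> to bounded, almost everywhere continuous functions supported in a window: approximate such
  an \<open>F\<close> from below by Lipschitz functions times a cutoff, and apply the same to \<open>- F\<close>.  The last claim
  uses the indicator of an orthant for \<open>G\<close>, whose boundary is not charged because coordinate
  hyperplanes are null for \<open>theta\<close>; integrating out \<open>theta\<close> first gives the constant.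
\<close>

section \<open>Locally uniform convergence\<close>

text \<open>A minorant of \<open>F\<close> need not be supported in a window, so it is not yet a
  test function. The cutoff repairs this at no cost: inside the support window it equals 1, and
  outside, where \<open>F = 0\<close> and the minorant is at most 0, a nonnegative factor keeps the
  product at most 0. The products live in the window with halved thresholds, which has finite
  measure and so supplies the dominating function. No sign condition on \<open>F\<close> arises,
  which is what allows one lower bound to serve for both \<open>F\<close> and \<open>- F\<close>.
  Windows are kept manageable by a second observation: a strict lower bound on a supremum amounts to
  a witness point. Openness, nonvanishing of coordinates and rescaling of windows thus become
  statements about single values \<open>f t\<close>, and no identity for rescaled suprema has to be
  established.\<close>

lemma compactin_Euclidean_cube:
  "compactin (Euclidean_space m) {x \<in> topspace (Euclidean_space m). \<forall>j<m. \<bar>x j\<bar> \<le> c}"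
proof -
  \<comment> \<open>Points of \<open>Euclidean_space m\<close> are sequences that vanish from index
    \<open>m\<close> on, so the cube is a full product of intervals and singletons, and Tychonoff
    applies.\<close>
  have eq: "{x \<in> topspace (Euclidean_space m). \<forall>j<m. \<bar>x j\<bar> \<le> c}
      = PiE UNIV (\<lambda>j. if j < m then {- c..c} else {0})" (is "?S = _")
  proof (intro set_eqI iffI)
    fix x assume "x \<in> ?S"
    then show "x \<in> PiE UNIV (\<lambda>j. if j < m then {- c..c} else {0})"
      by (auto simp: topspace_Euclidean_space abs_le_iff minus_le_iff)
  next
    fix x assume "x \<in> PiE UNIV (\<lambda>j. if j < m then {- c..c} else {0})"
    then have "x j \<in> (if j < m then {- c..c} else {0})" for j by (rule PiE_mem) simp
    then have "j < m \<Longrightarrow> x j \<in> {- c..c}" "\<not> j < m \<Longrightarrow> x j = 0" for j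
      by (metis, metis singletonD)
    then show "x \<in> ?S"
      by (auto simp: topspace_Euclidean_space abs_le_iff minus_le_iff)
  qed
  have "compactin (powertop_real UNIV) ?S"
    unfolding eq by (subst compactin_PiE) auto
  then show ?thesis
    unfolding Euclidean_space_def by (auto simp: compactin_subtopology)
qed

text \<open>In the discrete case the conclusion is among the assumed conjuncts, and the final
  \<open>qed\<close> closes it. For R^m, a compact set pulls back along \<open>h\<close> to one with
  compact, hence bounded, coordinate projections; only the coordinates below \<open>m\<close> vary,
  so one cube contains it.\<close>

lemma index_exhaustion_imp_compact_exhaustion:
  fixes K :: "nat \<Rightarrow> 't::topological_space set"
  assumes "index_exhaustion K"
  shows "compact_exhaustion K"
  using assms unfolding index_exhaustion_def
proof (elim disjE exE conjE)
  fix m and h :: "(nat \<Rightarrow> real) \<Rightarrow> 't"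
  let ?E = "Euclidean_space m"
  let ?C = "\<lambda>n. {x \<in> topspace ?E. \<forall>j<m. \<bar>x j\<bar> \<le> real n}"
  assume h: "homeomorphic_map ?E euclidean h" and K: "\<forall>n\<ge>1. K n = h ` ?C n"
  have onto: "h ` topspace ?E = UNIV"
    using homeomorphic_imp_surjective_map[OF h] by simp
  have sub: "\<exists>n\<ge>1. L \<subseteq> K n" if L: "compact L" for L
  proof -
    obtain P where P: "P \<subseteq> topspace ?E" "L = h ` P"
      using onto by (metis subset_imageE top_greatest)
    have "compactin ?E P"
      using L P homeomorphic_map_compactness[OF h P(1)] by simp
    then have "compactin (powertop_real UNIV) P"
      unfolding Euclidean_space_def by (simp add: compactin_subtopology)
    then have "compact ((\<lambda>x. x j) ` P)" for j
      using image_compactin[of "powertop_real UNIV" P euclideanreal "\<lambda>x. x j"]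
        continuous_map_product_projection[of j UNIV "\<lambda>_. euclideanreal"]
      by simp
    then have "\<exists>B. \<forall>x\<in>P. \<bar>x j\<bar> \<le> B" for j
      using compact_imp_bounded[of "(\<lambda>x. x j) ` P"] unfolding bounded_real by blast
    then obtain B where B: "\<And>j x. x \<in> P \<Longrightarrow> \<bar>x j\<bar> \<le> B j" by metis
    \<comment> \<open>The sum dominates every single bound, and adding 1 secures
      \<open>n \<ge> 1\<close>.\<close>
    define n where "n = nat \<lceil>\<Sum>j<m. \<bar>B j\<bar>\<rceil> + 1"
    have "\<bar>x j\<bar> \<le> real n" if "x \<in> P" "j < m" for x j
    proof -
      have "\<bar>x j\<bar> \<le> \<bar>B j\<bar>" using B[OF that(1), of j] by linarith
      also have "\<dots> \<le> (\<Sum>j<m. \<bar>B j\<bar>)"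
        using that by (intro member_le_sum) auto
      also have "\<dots> \<le> real n" unfolding n_def by linarith
      finally show ?thesis .
    qed
    then have "L \<subseteq> K n" using P K by (auto simp: n_def)
    then show ?thesis by (intro exI[of _ n]) (auto simp: n_def)
  qed
  have cpt: "compact (K n)" if "n \<ge> 1" for n
    using homeomorphic_map_compactness[OF h, of "?C n"] K that compactin_Euclidean_cube
    by (auto simp: subset_eq)
  have "(\<lambda>_. 0) \<in> ?C n" for n by (simp add: topspace_Euclidean_space)
  then have ne: "K n \<noteq> {}" if "n \<ge> 1" for n using K that by blast
  have mono: "K n \<subseteq> K (Suc n)" if "n \<ge> 1" for n
  proof -
    have "?C n \<subseteq> ?C (Suc n)" by (auto intro: order_trans)
    then show ?thesis using K that by (simp add: image_mono)
  qed
  have "\<exists>n\<ge>1. t \<in> K n" for t using sub[of "{t}"] by auto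
  then have "(\<Union>n\<in>{1..}. K n) = UNIV" by auto
  then show ?thesis
    unfolding compact_exhaustion_def using cpt ne mono sub by blast
qed

lemma compact_exhaustion_mono:
  assumes "compact_exhaustion K" "1 \<le> m" "m \<le> n"
  shows "K m \<subseteq> K n"
  using assms(3)
proof (induction n rule: dec_induct)
  case (step n)
  then show ?case using assms(1,2) unfolding compact_exhaustion_def by (meson le_trans subset_trans)
qed simp

lemma compact_exhaustion_props:
  assumes "compact_exhaustion K" "n \<ge> 1"
  shows "compact (K n)" "K n \<noteq> {}"
  using assms by (auto simp: compact_exhaustion_def)

text \<open>For nonempty compact \<open>L\<close> this is a pseudometric on \<open>CT\<close>, and
  those belonging to the sets of an exhaustion together induce the topology. Over an empty
  \<open>L\<close> the supremum carries no information, hence the nonemptiness assumptions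
  below.\<close>

definition sup_dist :: "'t set \<Rightarrow> ('t::topological_space \<Rightarrow> real ^ 'q) \<Rightarrow> ('t \<Rightarrow> real ^ 'q) \<Rightarrow> real" where
  "sup_dist L f g = (SUP t\<in>L. dist (f t) (g t))"

lemma bdd_above_dist_CT:
  fixes f g :: "'t::topological_space \<Rightarrow> real ^ 'q"
  assumes "compact L" "f \<in> CT" "g \<in> CT"
  shows "bdd_above ((\<lambda>t. dist (f t) (g t)) ` L)"
proof -
  have "continuous_on L f" "continuous_on L g"
    using assms continuous_on_subset unfolding CT_def by blast+
  then have "compact ((\<lambda>t. dist (f t) (g t)) ` L)"
    using assms(1) by (intro compact_continuous_image continuous_on_dist)
  then show ?thesis by (simp add: bounded_imp_bdd_above compact_imp_bounded)
qed

lemma dist_le_sup_dist: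
  assumes "compact L" "f \<in> CT" "g \<in> CT" "t \<in> L"
  shows "dist (f t) (g t) \<le> sup_dist L f g"
  unfolding sup_dist_def using assms by (intro cSUP_upper bdd_above_dist_CT)

lemma sup_dist_le:
  assumes "L \<noteq> {}" "\<And>t. t \<in> L \<Longrightarrow> dist (f t) (g t) \<le> c"
  shows "sup_dist L f g \<le> c"
  unfolding sup_dist_def using assms by (intro cSUP_least)

lemma sup_dist_nonneg:
  assumes "compact L" "L \<noteq> {}" "f \<in> CT" "g \<in> CT"
  shows "0 \<le> sup_dist L f g"
proof -
  obtain t where "t \<in> L" using assms by blast
  from dist_le_sup_dist[OF assms(1,3,4) this] show ?thesis
    using zero_le_dist[of "f t" "g t"] by linarith
qed

lemma sup_dist_triangle:
  assumes "compact L" "L \<noteq> {}" "f \<in> CT" "g \<in> CT" "h \<in> CT"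
  shows "sup_dist L f h \<le> sup_dist L f g + sup_dist L g h"
proof (rule sup_dist_le[OF assms(2)])
  fix t assume "t \<in> L"
  then show "dist (f t) (h t) \<le> sup_dist L f g + sup_dist L g h"
    using dist_le_sup_dist[OF assms(1,3,4), of t] dist_le_sup_dist[OF assms(1,4,5), of t]
      dist_triangle[of "f t" "h t" "g t"] by linarith
qed

lemma bdd_above_component_CT:
  fixes f :: "'t::topological_space \<Rightarrow> real ^ 'q"
  assumes "compact L" "f \<in> CT"
  shows "bdd_above ((\<lambda>t. \<bar>f t $ i\<bar>) ` L)"
proof -
  have "continuous_on L f"
    using assms continuous_on_subset unfolding CT_def by blast
  then have "compact ((\<lambda>t. \<bar>f t $ i\<bar>) ` L)"
    using assms(1) by (intro compact_continuous_image continuous_intros)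
  then show ?thesis by (simp add: bounded_imp_bdd_above compact_imp_bounded)
qed

lemma rho_le_rho_plus_sup_dist:
  assumes "compact (K n)" "K n \<noteq> {}" "f \<in> CT" "g \<in> CT"
  shows "rho K n i f \<le> rho K n i g + sup_dist (K n) f g"
  unfolding rho_def[of K n i f]
proof (rule cSUP_least[OF assms(2)])
  fix t assume t: "t \<in> K n"
  have "\<bar>f t $ i\<bar> \<le> \<bar>g t $ i\<bar> + dist (f t) (g t)"
    using component_le_norm_cart[of "f t - g t" i] by (simp add: dist_norm)
  moreover have "\<bar>g t $ i\<bar> \<le> rho K n i g"
    unfolding rho_def using t assms by (intro cSUP_upper bdd_above_component_CT)
  ultimately show "\<bar>f t $ i\<bar> \<le> rho K n i g + sup_dist (K n) f g"
    using dist_le_sup_dist[OF assms(1,3,4) t] by linarith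
qed

text \<open>This trades a window condition for a witness point, after which scaling and nonvanishing
  can be checked pointwise.\<close>

lemma less_rho_iff:
  assumes "compact (K n)" "K n \<noteq> {}" "f \<in> CT"
  shows "c < rho K n i f \<longleftrightarrow> (\<exists>t\<in>K n. c < \<bar>f t $ i\<bar>)"
  unfolding rho_def using assms by (intro less_cSUP_iff bdd_above_component_CT)

lemma openin_lu_ball:
  assumes "f \<in> CT" "compact L" "e > 0"
  shows "\<exists>U. openin lu_topology U \<and> f \<in> U \<and> (\<forall>g\<in>U. g \<in> CT \<and> (\<forall>t\<in>L. dist (g t) (f t) < e))"
proof (cases "L = {}")
  case True
  then show ?thesis
    using assms(1) openin_topspace[of lu_topology] unfolding topspace_lu_topology by blast
next
  case False
  \<comment> \<open>Bounding the supremum, rather than each distance, leaves positive room around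
    every point of the ball.\<close>
  define U where "U = {g\<in>CT. sup_dist L g f < e}"
  have "lu_open U"
    unfolding lu_open_def
  proof (intro conjI ballI)
    show "U \<subseteq> CT" by (auto simp: U_def)
    fix g assume g: "g \<in> U"
    \<comment> \<open>Only half of the room is used, because strict pointwise bounds yield a
      non-strict bound on the supremum.\<close>
    define d where "d = (e - sup_dist L g f) / 2"
    have d: "d > 0" using g by (simp add: d_def U_def)
    have "k \<in> U" if "k \<in> CT" "\<forall>t\<in>L. dist (k t) (g t) < d" for k
    proof -
      have "sup_dist L k g \<le> d" using that False by (intro sup_dist_le) (auto intro: less_imp_le)
      then show ?thesis
        using sup_dist_triangle[OF assms(2) False that(1) _ assms(1), of g] g d that
        by (auto simp: U_def d_def field_simps)
    qed
    then show "\<exists>L e. compact L \<and> 0 < e \<and> (\<forall>k\<in>CT. (\<forall>t\<in>L. dist (k t) (g t) < e) \<longrightarrow> k \<in> U)"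
      using d assms(2) by blast
  qed
  moreover have "f \<in> U"
    using assms sup_dist_le[OF False, of f f 0] by (auto simp: U_def)
  moreover have "dist (g t) (f t) < e" if "g \<in> U" "t \<in> L" for g t
    using that dist_le_sup_dist[OF assms(2) _ assms(1) that(2), of g] by (auto simp: U_def)
  ultimately show ?thesis
    by (intro exI[of _ U]) (auto simp: openin_lu_topology U_def)
qed

text \<open>The left side omits the point \<open>f\<close> while the right side admits
  \<open>g = f\<close>; this makes no difference, since the value compared with itself has distance
  0.\<close>

lemma tendsto_atin_lu_topology:
  fixes F :: "('t::topological_space \<Rightarrow> real ^ 'q) \<Rightarrow> 'b::metric_space"
  assumes f: "f \<in> CT"
  shows "(F \<longlongrightarrow> F f) (atin lu_topology f) \<longleftrightarrow>
    (\<forall>e>0. \<exists>L d. compact L \<and> d > 0 \<and>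
       (\<forall>g\<in>CT. (\<forall>t\<in>L. dist (g t) (f t) < d) \<longrightarrow> dist (F g) (F f) < e))" (is "?A \<longleftrightarrow> ?B")
proof
  assume A: ?A
  show ?B
  proof (intro allI impI)
    fix e :: real assume "e > 0"
    then have "eventually (\<lambda>g. dist (F g) (F f) < e) (atin lu_topology f)"
      using A by (simp add: tendsto_iff)
    then obtain U where "openin lu_topology U" "f \<in> U" "\<forall>g\<in>U - {f}. dist (F g) (F f) < e"
      using f by (auto simp: eventually_atin topspace_lu_topology)
    then show "\<exists>L d. compact L \<and> d > 0 \<and>
       (\<forall>g\<in>CT. (\<forall>t\<in>L. dist (g t) (f t) < d) \<longrightarrow> dist (F g) (F f) < e)"
      unfolding openin_lu_topology lu_open_def using \<open>e > 0\<close>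
      by (metis Diff_iff dist_self empty_iff insert_iff)
  qed
next
  assume B: ?B
  show ?A
    unfolding tendsto_iff
  proof (intro allI impI)
    fix e :: real assume "e > 0"
    with B obtain L d where L: "compact L" "d > 0"
      "\<forall>g\<in>CT. (\<forall>t\<in>L. dist (g t) (f t) < d) \<longrightarrow> dist (F g) (F f) < e"
      by meson
    with openin_lu_ball[OF f L(1,2)] show "eventually (\<lambda>g. dist (F g) (F f) < e) (atin lu_topology f)"
      unfolding eventually_atin by (metis Diff_iff)
  qed
qed

text \<open>A one-sided estimate is enough, as \<open>f\<close> and \<open>g\<close> may be
  exchanged.\<close>

lemma continuous_map_lu_topology_Lipschitz:
  fixes F :: "('t::topological_space \<Rightarrow> real ^ 'q) \<Rightarrow> real"
  assumes L: "compact L" "L \<noteq> {}"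
    and F: "\<And>f g. f \<in> CT \<Longrightarrow> g \<in> CT \<Longrightarrow> F f \<le> F g + c * sup_dist L f g"
  shows "continuous_map lu_topology euclideanreal F"
  unfolding continuous_map_atin limitin_canonical_iff topspace_lu_topology
proof
  fix f :: "'t \<Rightarrow> real ^ 'q" assume f: "f \<in> CT"
  show "(F \<longlongrightarrow> F f) (atin lu_topology f)"
    unfolding tendsto_atin_lu_topology[OF f]
  proof (intro allI impI)
    fix e :: real assume e: "e > 0"
    \<comment> \<open>\<open>\<bar>c\<bar> + 1\<close> is positive for every real \<open>c\<close>,
      and the factor 2 makes the resulting bound \<open>e / 2\<close> strictly smaller than
      \<open>e\<close>.\<close>
    define d where "d = e / (2 * (\<bar>c\<bar> + 1))"
    have d: "d > 0" using e by (simp add: d_def)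
    have "dist (F g) (F f) < e" if g: "g \<in> CT" "\<forall>t\<in>L. dist (g t) (f t) < d" for g
    proof -
      have "c * s < e" if "0 \<le> s" "s \<le> d" for s
      proof -
        have "c * s \<le> (\<bar>c\<bar> + 1) * d" using that by (intro mult_mono) auto
        also have "\<dots> < e" using e by (simp add: d_def field_simps add_pos_nonneg)
        finally show ?thesis .
      qed
      moreover have "sup_dist L g f \<le> d" "sup_dist L f g \<le> d"
        using g(2) by (auto intro!: sup_dist_le[OF L(2)] simp: dist_commute less_imp_le)
      ultimately have "c * sup_dist L g f < e" "c * sup_dist L f g < e"
        using sup_dist_nonneg[OF L] f g(1) by blast+
      then show ?thesis using F[OF f g(1)] F[OF g(1) f] by (simp add: dist_real_def)
    qed
    then show "\<exists>L d. compact L \<and> d > 0 \<and>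
       (\<forall>g\<in>CT. (\<forall>t\<in>L. dist (g t) (f t) < d) \<longrightarrow> dist (F g) (F f) < e)"
      using L(1) d by blast
  qed
qed

section \<open>Borel structure of the path space\<close>

lemma space_borel_CT: "space borel_CT = CT"
  by (simp add: borel_CT_def space_measure_of_conv)

lemma sets_borel_CT_open: "openin lu_topology U \<Longrightarrow> U \<in> sets borel_CT"
  using openin_subset[of lu_topology] unfolding borel_CT_def
  by (subst sets_measure_of) (auto simp: topspace_lu_topology)

lemma continuous_map_borel_CT:
  fixes F :: "_ \<Rightarrow> 'b::topological_space"
  assumes "continuous_map lu_topology euclidean F"
  shows "F \<in> borel_CT \<rightarrow>\<^sub>M borel"
proof (rule borel_measurableI)
  fix S :: "'b set" assume "open S"
  then have "openin lu_topology {f \<in> CT. F f \<in> S}"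
    using openin_continuous_map_preimage[OF assms, of S] by (simp add: topspace_lu_topology)
  moreover have "F -` S \<inter> space borel_CT = {f \<in> CT. F f \<in> S}" by (auto simp: space_borel_CT)
  ultimately show "F -` S \<inter> space borel_CT \<in> sets borel_CT" by (simp add: sets_borel_CT_open)
qed

lemma continuous_map_rho:
  assumes "compact (K n)" "K n \<noteq> {}"
  shows "continuous_map lu_topology euclideanreal (rho K n i)"
  using assms rho_le_rho_plus_sup_dist[of K n]
  by (intro continuous_map_lu_topology_Lipschitz[OF assms, where c = 1]) simp

lemma norm_mult_vec_le:
  fixes r :: "real ^ 'q"
  shows "\<exists>B>0. \<forall>x. norm (r * x) \<le> B * norm x"
proof -
  have "linear (\<lambda>x. r * x)" by (rule linearI) (simp_all add: vec_eq_iff algebra_simps)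
  then have "bounded_linear (\<lambda>x. r * x)" by (simp add: linear_linear)
  from bounded_linear.pos_bounded[OF this] show ?thesis by (metis mult.commute)
qed

lemma scale_fun_in_CT:
  assumes "f \<in> CT" shows "r \<odot> f \<in> CT"
proof -
  have "linear (\<lambda>x. r * x)" by (rule linearI) (simp_all add: vec_eq_iff algebra_simps)
  then have "continuous_on UNIV (\<lambda>t. r * f t)"
    using assms linear_linear[of "\<lambda>x. r * x"]
      continuous_on_compose2[OF linear_continuous_on[of "\<lambda>x. r * x" UNIV], of UNIV f]
    by (auto simp: CT_def)
  then show ?thesis by (simp add: CT_def scale_fun_def)
qed

text \<open>Multiplication by a fixed \<open>r\<close> is bounded linear, so preimages of open sets
  are open: the compact set is kept and the radius is divided by the operator bound
  \<open>B\<close>.\<close>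

lemma measurable_scale_fun:
  "(\<lambda>f. r \<odot> f) \<in> (borel_CT :: ('t::topological_space \<Rightarrow> real ^ 'q) measure) \<rightarrow>\<^sub>M borel_CT"
  unfolding borel_CT_def
proof (rule measurable_measure_of, goal_cases)
  case 1
  then show ?case using openin_subset[of lu_topology] by (auto simp: topspace_lu_topology)
next
  case 2
  then show ?case by (auto simp: scale_fun_in_CT space_measure_of_conv)
next
  case (3 U)
  then have U: "lu_open U" by (simp add: openin_lu_topology)
  obtain B where B: "B > 0" "\<And>x. norm (r * x) \<le> B * norm x" using norm_mult_vec_le by metis
  have "lu_open ((\<odot>) r -` U \<inter> CT)"
    unfolding lu_open_def
  proof (intro conjI ballI)
    fix f assume f: "f \<in> (\<odot>) r -` U \<inter> CT"
    with U obtain L e where L: "compact L" "e > 0"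
      "\<forall>g\<in>CT. (\<forall>t\<in>L. dist (g t) ((r \<odot> f) t) < e) \<longrightarrow> g \<in> U"
      unfolding lu_open_def by (metis IntD1 vimageD)
    have "r \<odot> g \<in> U" if g: "g \<in> CT" "\<forall>t\<in>L. dist (g t) (f t) < e / B" for g
    proof -
      have "dist ((r \<odot> g) t) ((r \<odot> f) t) < e" if "t \<in> L" for t
      proof -
        have "dist ((r \<odot> g) t) ((r \<odot> f) t) \<le> B * dist (g t) (f t)"
          using B(2)[of "g t - f t"] by (simp add: scale_fun_def dist_norm algebra_simps)
        also have "\<dots> < e" using g(2) that B(1) by (auto simp: field_simps)
        finally show ?thesis .
      qed
      then show ?thesis using L(3) g(1) scale_fun_in_CT by blast
    qed
    then show "\<exists>L e. compact L \<and> 0 < e \<and>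
        (\<forall>g\<in>CT. (\<forall>t\<in>L. dist (g t) (f t) < e) \<longrightarrow> g \<in> (\<odot>) r -` U \<inter> CT)"
      using L(1,2) B(1) by (intro exI[of _ L] exI[of _ "e / B"]) auto
  qed auto
  then have "(\<odot>) r -` U \<inter> CT \<in> sets borel_CT"
    by (intro sets_borel_CT_open) (simp add: openin_lu_topology)
  then show ?case by (simp add: borel_CT_def space_measure_of_conv)
qed

lemma window_mem_sets:
  assumes K: "compact_exhaustion K" and n: "\<forall>i. n i \<ge> 1"
  shows "window K n \<epsilon> \<in> sets (borel_CT :: ('t::topological_space \<Rightarrow> real ^ 'q) measure)"
proof -
  have [measurable]: "rho K (n i) i \<in> borel_measurable (borel_CT :: ('t \<Rightarrow> real ^ 'q) measure)" for i
    using compact_exhaustion_props[OF K n[rule_format]]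
    by (intro continuous_map_borel_CT continuous_map_rho)
  have "{f \<in> space (borel_CT :: ('t \<Rightarrow> real ^ 'q) measure). \<forall>i. rho K (n i) i f > \<epsilon> $ i} \<in> sets borel_CT"
    by measurable
  then show ?thesis by (simp add: window_def space_borel_CT)
qed

lemma window_subset_CPi:
  assumes K: "compact_exhaustion K" and n: "\<forall>i. n i \<ge> 1" and e: "\<epsilon> \<in> pos_vecs"
  shows "window K n \<epsilon> \<subseteq> CPi"
proof
  fix f assume f: "f \<in> window K n \<epsilon>"
  have "\<exists>t. f t $ i \<noteq> 0" for i
  proof -
    have "\<epsilon> $ i < rho K (n i) i f" "f \<in> CT" using f by (auto simp: window_def)
    then obtain t where "\<epsilon> $ i < \<bar>f t $ i\<bar>"
      using less_rho_iff[of K "n i" f "\<epsilon> $ i" i] compact_exhaustion_props[OF K n[rule_format]] by blast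
    moreover have "\<epsilon> $ i > 0" using e by (simp add: pos_vecs_def)
    ultimately show ?thesis by (intro exI[of _ t]) auto
  qed
  then show "f \<in> CPi" using f by (auto simp: CPi_def window_def)
qed

section \<open>Limits along almost everywhere continuous functions\<close>

text \<open>Homogeneity and the sign of \<open>rate b u\<close> are available for positive
  \<open>u\<close>; this lets each limit argument restrict to such \<open>u\<close>.\<close>

lemma eventually_to_infty_pos_vecs: "eventually (\<lambda>u. u \<in> (pos_vecs :: (real ^ 'q) set)) to_infty"
  unfolding to_infty_def eventually_filtercomap
proof (intro exI conjI allI impI)
  show "eventually (\<lambda>x. x > (0::real)) at_top" by (rule eventually_gt_at_top)
  fix u :: "real ^ 'q" assume "Min (range (\<lambda>i. u $ i)) > 0"
  then show "u \<in> pos_vecs" by (simp add: pos_vecs_def)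
qed

lemma vinv_pos_vecs: "u \<in> pos_vecs \<Longrightarrow> vinv u \<in> pos_vecs"
  by (simp add: pos_vecs_def vinv_def)

lemma rate_nonneg:
  assumes "\<And>i. regularly_varying (b i) (\<alpha> $ i)" "u \<in> pos_vecs"
  shows "0 \<le> rate b u"
  unfolding rate_def using assms
  by (intro prod_nonneg less_imp_le) (auto simp: regularly_varying_def pos_vecs_def)

text \<open>Each factor is a ramp in the seminorm, rising linearly from 0 at
  \<open>\<epsilon> $ i / 2\<close> to 1 at \<open>\<epsilon> $ i\<close>. Halving leaves room for
  continuity while the thresholds stay positive.\<close>

definition cutoff :: "(nat \<Rightarrow> 't::topological_space set) \<Rightarrow> ('q \<Rightarrow> nat) \<Rightarrow> real ^ 'q \<Rightarrow>
    ('t \<Rightarrow> real ^ 'q) \<Rightarrow> real" where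
  "cutoff K n \<epsilon> f = (\<Prod>i\<in>UNIV. max 0 (min 1 (2 * rho K (n i) i f / \<epsilon> $ i - 1)))"

lemma cutoff_bounds: "0 \<le> cutoff K n \<epsilon> f" "cutoff K n \<epsilon> f \<le> 1"
  unfolding cutoff_def by (intro prod_nonneg prod_le_1; simp)+

lemma cutoff_eq_1:
  assumes "\<epsilon> \<in> pos_vecs" "f \<in> window K n \<epsilon>"
  shows "cutoff K n \<epsilon> f = 1"
proof -
  have "max 0 (min 1 (2 * rho K (n i) i f / \<epsilon> $ i - 1)) = 1" for i
  proof -
    have "\<epsilon> $ i > 0" "\<epsilon> $ i < rho K (n i) i f"
      using assms by (auto simp: pos_vecs_def window_def)
    then have "1 \<le> 2 * rho K (n i) i f / \<epsilon> $ i - 1" by (simp add: field_simps)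
    then show ?thesis by simp
  qed
  then show ?thesis by (simp add: cutoff_def)
qed

lemma cutoff_eq_0:
  assumes "\<epsilon> \<in> pos_vecs" "f \<in> CT" "f \<notin> window K n ((1/2) *\<^sub>R \<epsilon>)"
  shows "cutoff K n \<epsilon> f = 0"
proof -
  obtain i where i: "rho K (n i) i f \<le> \<epsilon> $ i / 2" using assms(2,3) by (auto simp: window_def not_less)
  have "\<epsilon> $ i > 0" using assms by (auto simp: pos_vecs_def)
  with i have "2 * rho K (n i) i f / \<epsilon> $ i - 1 \<le> 0" by (simp add: field_simps)
  then have "max 0 (min 1 (2 * rho K (n i) i f / \<epsilon> $ i - 1)) = 0" by simp
  then show ?thesis unfolding cutoff_def by (intro prod_zero) auto
qed

lemma continuous_map_cutoff:
  assumes "compact_exhaustion K" "\<forall>i. n i \<ge> 1"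
  shows "continuous_map lu_topology euclideanreal (cutoff K n \<epsilon>)"
proof -
  have "continuous_map lu_topology euclideanreal (rho K (n i) i)" for i
    using assms by (intro continuous_map_rho compact_exhaustion_props) auto
  then show ?thesis
    unfolding cutoff_def divide_inverse continuous_map_atin limitin_canonical_iff
    by (intro ballI tendsto_prod tendsto_max tendsto_min tendsto_diff tendsto_mult tendsto_const) simp
qed

text \<open>
  The minorants increase to the lower semicontinuous envelope of \<open>F\<close>, hence to \<open>F\<close> itself at its
  points of continuity.  Letting the compact set grow with the Lipschitz constant makes a metric
  for locally uniform convergence unnecessary.
\<close>

definition minorant :: "(nat \<Rightarrow> 't::topological_space set) \<Rightarrow> nat \<Rightarrow>
    (('t \<Rightarrow> real ^ 'q) \<Rightarrow> real) \<Rightarrow> ('t \<Rightarrow> real ^ 'q) \<Rightarrow> real" where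
  "minorant K k F f = (INF g\<in>CT. F g + real k * sup_dist (K k) f g)"

context
  fixes K :: "nat \<Rightarrow> 't::topological_space set" and F :: "('t \<Rightarrow> real ^ 'q) \<Rightarrow> real" and C :: real
  assumes K: "compact_exhaustion K" and F_bound: "\<forall>f\<in>CT. \<bar>F f\<bar> \<le> C"
begin

lemma minorant_bdd_below:
  assumes "k \<ge> 1" "f \<in> CT"
  shows "bdd_below ((\<lambda>g. F g + real k * sup_dist (K k) f g) ` CT)"
proof (rule bdd_belowI2[where m = "- C"])
  fix g :: "'t \<Rightarrow> real ^ 'q" assume "g \<in> CT"
  then have "0 \<le> real k * sup_dist (K k) f g"
    using sup_dist_nonneg[OF compact_exhaustion_props[OF K assms(1)] assms(2)] by simp
  then show "- C \<le> F g + real k * sup_dist (K k) f g" using bspec[OF F_bound, OF \<open>g \<in> CT\<close>] by linarith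
qed

lemma minorant_le:
  assumes "k \<ge> 1" "f \<in> CT" "g \<in> CT"
  shows "minorant K k F f \<le> F g + real k * sup_dist (K k) f g"
  unfolding minorant_def by (rule cINF_lower[OF minorant_bdd_below[OF assms(1,2)] assms(3)])

lemma minorant_le_self:
  assumes "k \<ge> 1" "f \<in> CT"
  shows "minorant K k F f \<le> F f"
proof -
  have "sup_dist (K k) f f \<le> 0"
    using compact_exhaustion_props[OF K assms(1)] by (intro sup_dist_le) auto
  then have "real k * sup_dist (K k) f f \<le> 0" by (simp add: mult_nonneg_nonpos)
  then show ?thesis using minorant_le[OF assms assms(2)] by linarith
qed

lemma minorant_ge:
  assumes "f \<in> CT" "\<And>g. g \<in> CT \<Longrightarrow> c \<le> F g + real k * sup_dist (K k) f g"
  shows "c \<le> minorant K k F f"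
  unfolding minorant_def using assms by (intro cINF_greatest) auto

lemma minorant_abs_le:
  assumes "k \<ge> 1" "f \<in> CT"
  shows "\<bar>minorant K k F f\<bar> \<le> C"
proof -
  have "- C \<le> minorant K k F f"
  proof (rule minorant_ge[OF assms(2)])
    fix g :: "'t \<Rightarrow> real ^ 'q" assume "g \<in> CT"
    then have "0 \<le> real k * sup_dist (K k) f g"
      using sup_dist_nonneg[OF compact_exhaustion_props[OF K assms(1)] assms(2)] by simp
    then show "- C \<le> F g + real k * sup_dist (K k) f g" using bspec[OF F_bound, OF \<open>g \<in> CT\<close>] by linarith
  qed
  then show ?thesis using minorant_le_self[OF assms] bspec[OF F_bound, OF assms(2)] by linarith
qed

text \<open>The functions under the infimum share the Lipschitz constant \<open>k\<close> for
  \<open>sup_dist (K k)\<close>, and an infimum preserves a common constant.\<close>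

lemma continuous_map_minorant:
  assumes "k \<ge> 1"
  shows "continuous_map lu_topology euclideanreal (minorant K k F)"
proof (rule continuous_map_lu_topology_Lipschitz[OF compact_exhaustion_props[OF K assms], where c = "real k"])
  fix f f' :: "'t \<Rightarrow> real ^ 'q" assume f: "f \<in> CT" "f' \<in> CT"
  have "minorant K k F f - real k * sup_dist (K k) f f' \<le> minorant K k F f'"
  proof (rule minorant_ge[OF f(2)])
    fix g :: "'t \<Rightarrow> real ^ 'q" assume g: "g \<in> CT"
    have "real k * sup_dist (K k) f g \<le> real k * (sup_dist (K k) f f' + sup_dist (K k) f' g)"
      by (intro mult_left_mono sup_dist_triangle compact_exhaustion_props[OF K assms] f g) simp
    then show "minorant K k F f - real k * sup_dist (K k) f f' \<le> F g + real k * sup_dist (K k) f' g"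
      using minorant_le[OF assms f(1) g] by (simp add: algebra_simps)
  qed
  then show "minorant K k F f \<le> minorant K k F f' + real k * sup_dist (K k) f f'" by simp
qed

text \<open>Competitors \<open>g\<close> close to \<open>f\<close> on \<open>K k\<close> have nearly
  the value \<open>F f\<close> by continuity; for all others the penalty exceeds the possible gain
  \<open>2 * C\<close>.\<close>

lemma minorant_tendsto:
  assumes f: "f \<in> CT" and cont: "(F \<longlongrightarrow> F f) (atin lu_topology f)"
  shows "(\<lambda>k. minorant K k F f) \<longlonglongrightarrow> F f"
proof (rule LIMSEQ_I)
  fix e :: real assume e: "0 < e"
  obtain L d where L: "compact L" "d > 0"
    "\<forall>g\<in>CT. (\<forall>t\<in>L. dist (g t) (f t) < d) \<longrightarrow> dist (F g) (F f) < e / 2"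
    using cont[unfolded tendsto_atin_lu_topology[OF f], rule_format, OF half_gt_zero[OF e]] by blast
  obtain m where m: "m \<ge> 1" "L \<subseteq> K m" using K L(1) by (auto simp: compact_exhaustion_def)
  \<comment> \<open>From \<open>m\<close> on, \<open>K k\<close> contains \<open>L\<close>, so
    closeness on \<open>K k\<close> implies closeness on \<open>L\<close>. The other bound gives
    \<open>2 * C \<le> k * d\<close>, the price of being at distance \<open>d\<close> or
    more.\<close>
  define k0 where "k0 = max m (nat \<lceil>2 * C / d\<rceil>)"
  have "norm (minorant K k F f - F f) < e" if k: "k \<ge> k0" for k
  proof -
    have k1: "k \<ge> 1" and mk: "m \<le> k" using k m by (auto simp: k0_def)
    have LK: "L \<subseteq> K k" using compact_exhaustion_mono[OF K m(1) mk] m(2) by blast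
    have "2 * C / d \<le> real k" using k unfolding k0_def by linarith
    then have kd: "2 * C \<le> real k * d" using L(2) by (simp add: field_simps)
    have "F f - e / 2 \<le> minorant K k F f"
    proof (rule minorant_ge[OF f])
      fix g :: "'t \<Rightarrow> real ^ 'q" assume g: "g \<in> CT"
      note KK = compact_exhaustion_props[OF K k1]
      show "F f - e / 2 \<le> F g + real k * sup_dist (K k) f g"
      proof (cases "sup_dist (K k) f g < d")
        case True
        have "dist (g t) (f t) < d" if "t \<in> L" for t
          using dist_le_sup_dist[OF KK(1) f g] LK that True by (subst dist_commute) force
        then have "dist (F g) (F f) < e / 2" using L(3) g by blast
        moreover have "0 \<le> real k * sup_dist (K k) f g" using sup_dist_nonneg[OF KK f g] by simp
        ultimately show ?thesis unfolding dist_real_def by linarith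
      next
        case False
        then have "real k * d \<le> real k * sup_dist (K k) f g" by (intro mult_left_mono) auto
        then show ?thesis using kd bspec[OF F_bound, OF f] bspec[OF F_bound, OF g] e by linarith
      qed
    qed
    then show ?thesis using minorant_le_self[OF k1 f] e by simp
  qed
  then show "\<exists>k0. \<forall>k\<ge>k0. norm (minorant K k F f - F f) < e" by blast
qed

end

text \<open>A number below the target integral is already exceeded by the integral of a single test
  function lying below \<open>F\<close>. The assumed limit for that function, followed by
  monotonicity of the expectation, passes the bound on to \<open>F\<close>.\<close>

lemma RV_CT_liminf:
  fixes K :: "nat \<Rightarrow> 't::topological_space set" and F :: "('t \<Rightarrow> real ^ 'q) \<Rightarrow> real"
  assumes K: "compact_exhaustion K" and M: "prob_space M" and X: "RV_CT K \<alpha> \<nu> b M X"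
    and F: "F \<in> borel_measurable borel_CT" "\<forall>f\<in>CT. \<bar>F f\<bar> \<le> C"
    and n: "\<forall>i. n i \<ge> 1" and e: "\<epsilon> \<in> pos_vecs"
    and supp: "\<forall>f\<in>CT - window K n \<epsilon>. F f = 0"
    and cont: "AE f in \<nu>. (F \<longlongrightarrow> F f) (atin lu_topology f)"
    and c: "c < (\<integral>f. F f \<partial>\<nu>)"
  shows "eventually (\<lambda>u. c < rate b u * (\<integral>w. F (vinv u \<odot> X w) \<partial>M)) to_infty"
proof -
  interpret prob_space M by fact
  have sp: "space \<nu> = CPi" and st: "sets \<nu> = sets borel_CPi"
    and rv: "\<And>i. regularly_varying (b i) (\<alpha> $ i)" and Xm: "X \<in> M \<rightarrow>\<^sub>M borel_CT"
    using X by (auto simp: RV_CT_def)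
  define G where "G k f = cutoff K n \<epsilon> f * minorant K k F f" for k f
  let ?W = "window K n ((1/2) *\<^sub>R \<epsilon>)"
  have e2: "(1/2) *\<^sub>R \<epsilon> \<in> pos_vecs" using e by (simp add: pos_vecs_def)
  have WCPi: "?W \<subseteq> CPi" by (rule window_subset_CPi[OF K n e2])
  have W: "?W \<in> sets \<nu>"
    using WCPi window_mem_sets[OF K n, where \<epsilon> = "(1/2) *\<^sub>R \<epsilon>"]
    by (auto simp: st borel_CPi_def sets_restrict_space intro!: image_eqI[of _ _ ?W])
  have Wfin: "emeasure \<nu> ?W < \<infinity>" using X n e2 unfolding RV_CT_def by blast
  have ident: "(\<lambda>f. f) \<in> \<nu> \<rightarrow>\<^sub>M (borel_CT :: ('t \<Rightarrow> real ^ 'q) measure)"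
    using measurable_restrict_space1[of "\<lambda>f. f" borel_CT borel_CT CPi]
    by (simp add: measurable_cong_sets[OF st refl] borel_CPi_def)
  have Gcont: "continuous_map lu_topology euclideanreal (G k)" if "k \<ge> 1" for k
    unfolding G_def
    by (intro continuous_map_real_mult continuous_map_cutoff[OF K n] continuous_map_minorant[OF K F(2) that])
  have Gbd: "\<bar>G k f\<bar> \<le> C" if "k \<ge> 1" "f \<in> CT" for k f
  proof -
    have "\<bar>G k f\<bar> \<le> 1 * C"
      unfolding G_def abs_mult using that minorant_abs_le[OF K F(2)]
      by (intro mult_mono) (auto simp: cutoff_bounds)
    then show ?thesis by simp
  qed
  have G0: "G k f = 0" if "f \<in> CT" "f \<notin> ?W" for k f
    using cutoff_eq_0[OF e that] by (simp add: G_def)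
  \<comment> \<open>The cutoff multiplies a quantity of unknown sign, so this needs both regions: it
    is 1 on the window, and off the window the minorant is at most \<open>F f = 0\<close>.\<close>
  have GF: "G k f \<le> F f" if "k \<ge> 1" "f \<in> CT" for k f
  proof (cases "f \<in> window K n \<epsilon>")
    case True
    then show ?thesis using minorant_le_self[OF K F(2) that] cutoff_eq_1[OF e True] by (simp add: G_def)
  next
    case False
    then show ?thesis
      using minorant_le_self[OF K F(2) that] supp that cutoff_bounds(1)[of K n \<epsilon> f]
      by (simp add: G_def mult_nonneg_nonpos)
  qed
  have test: "G k \<in> test_CPi K" if "k \<ge> 1" for k
    unfolding test_CPi_def
  proof (intro CollectI conjI exI ballI)
    show "continuous_map lu_topology euclideanreal (G k)" by (rule Gcont[OF that])
    show "bounded (G k ` CT)" using Gbd[OF that] unfolding bounded_real by auto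
    show "\<forall>i. n i \<ge> 1" "(1/2) *\<^sub>R \<epsilon> \<in> pos_vecs" by (rule n e2)+
    show "G k f = 0" if "f \<in> CT - ?W" for f using G0 that by blast
  qed
  have CTC: "f \<in> CT" if "f \<in> CPi" for f using that by (simp add: CPi_def)
  \<comment> \<open>The shift to \<open>Suc k\<close> is needed because the exhaustion constrains
    \<open>K k\<close> for \<open>k \<ge> 1\<close> only.\<close>
  have "(\<lambda>k. \<integral>f. G (Suc k) f \<partial>\<nu>) \<longlonglongrightarrow> (\<integral>f. F f \<partial>\<nu>)"
  proof (rule integral_dominated_convergence[where w = "\<lambda>f. C * indicator ?W f"])
    show "F \<in> borel_measurable \<nu>" using measurable_compose[OF ident F(1)] by simp
    show "G (Suc k) \<in> borel_measurable \<nu>" for k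
      using measurable_compose[OF ident continuous_map_borel_CT[OF Gcont[of "Suc k"]]] by simp
    show "integrable \<nu> (\<lambda>f. C * indicator ?W f)"
      using W Wfin by (intro integrable_mult_right integrable_real_indicator) auto
    show "AE f in \<nu>. (\<lambda>k. G (Suc k) f) \<longlonglongrightarrow> F f"
      using cont AE_space
    proof eventually_elim
      case (elim f)
      then have f: "f \<in> CT" using CTC sp by blast
      have "(\<lambda>k. minorant K (Suc k) F f) \<longlonglongrightarrow> F f"
        using LIMSEQ_Suc[OF minorant_tendsto[OF K F(2) f elim(1)]] .
      then have "(\<lambda>k. G (Suc k) f) \<longlonglongrightarrow> cutoff K n \<epsilon> f * F f"
        unfolding G_def by (intro tendsto_intros)
      moreover have "cutoff K n \<epsilon> f * F f = F f"
        using cutoff_eq_1[OF e] supp f by (cases "f \<in> window K n \<epsilon>") auto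
      ultimately show ?case by simp
    qed
    show "AE f in \<nu>. norm (G (Suc k) f) \<le> C * indicator ?W f" for k
      using AE_space
    proof eventually_elim
      case (elim f)
      then have "f \<in> CT" using CTC sp by blast
      then show ?case using Gbd[of "Suc k" f] G0[of f] by (cases "f \<in> ?W") auto
    qed
  qed
  then have "eventually (\<lambda>k. c < (\<integral>f. G (Suc k) f \<partial>\<nu>)) sequentially"
    using c by (rule order_tendstoD)
  then obtain k where k: "c < (\<integral>f. G (Suc k) f \<partial>\<nu>)"
    unfolding eventually_sequentially by blast
  have "((\<lambda>u. rate b u * (\<integral>w. G (Suc k) (vinv u \<odot> X w) \<partial>M)) \<longlongrightarrow> (\<integral>f. G (Suc k) f \<partial>\<nu>)) to_infty"
    using X test[of "Suc k"] by (simp add: RV_CT_def)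
  then have "eventually (\<lambda>u. c < rate b u * (\<integral>w. G (Suc k) (vinv u \<odot> X w) \<partial>M)) to_infty"
    using k by (rule order_tendstoD)
  then show ?thesis
    using eventually_to_infty_pos_vecs
  proof eventually_elim
    case (elim u)
    have Xu: "(\<lambda>w. vinv u \<odot> X w) \<in> M \<rightarrow>\<^sub>M borel_CT"
      using measurable_compose[OF Xm measurable_scale_fun] .
    have XC: "vinv u \<odot> X w \<in> CT" if "w \<in> space M" for w
      using measurable_space[OF Xu that] by (simp add: space_borel_CT)
    have "(\<integral>w. G (Suc k) (vinv u \<odot> X w) \<partial>M) \<le> (\<integral>w. F (vinv u \<odot> X w) \<partial>M)"
    proof (rule integral_mono)
      show "integrable M (\<lambda>w. G (Suc k) (vinv u \<odot> X w))"
        using Gbd[of "Suc k"] XC measurable_compose[OF Xu continuous_map_borel_CT[OF Gcont[of "Suc k"]]]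
        by (intro integrable_const_bound[where B = C] AE_I2) simp_all
      show "integrable M (\<lambda>w. F (vinv u \<odot> X w))"
        using F(2) XC measurable_compose[OF Xu F(1)]
        by (intro integrable_const_bound[where B = C] AE_I2) simp_all
      show "G (Suc k) (vinv u \<odot> X w) \<le> F (vinv u \<odot> X w)" if "w \<in> space M" for w
        using GF[of "Suc k", OF _ XC[OF that]] by simp
    qed
    then have "rate b u * (\<integral>w. G (Suc k) (vinv u \<odot> X w) \<partial>M) \<le> rate b u * (\<integral>w. F (vinv u \<odot> X w) \<partial>M)"
      using rate_nonneg[OF rv elim(2)] by (rule mult_left_mono)
    then show ?case using elim(1) by linarith
  qed
qed

lemma RV_CT_tendsto_AE_continuous:
  fixes K :: "nat \<Rightarrow> 't::topological_space set" and F :: "('t \<Rightarrow> real ^ 'q) \<Rightarrow> real"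
  assumes K: "compact_exhaustion K" and M: "prob_space M" and X: "RV_CT K \<alpha> \<nu> b M X"
    and F: "F \<in> borel_measurable borel_CT" "\<forall>f\<in>CT. \<bar>F f\<bar> \<le> C"
    and n: "\<forall>i. n i \<ge> 1" and e: "\<epsilon> \<in> pos_vecs"
    and supp: "\<forall>f\<in>CT - window K n \<epsilon>. F f = 0"
    and cont: "AE f in \<nu>. (F \<longlongrightarrow> F f) (atin lu_topology f)"
  shows "((\<lambda>u. rate b u * (\<integral>w. F (vinv u \<odot> X w) \<partial>M)) \<longlongrightarrow> (\<integral>f. F f \<partial>\<nu>)) to_infty"
proof (rule order_tendstoI)
  fix c assume "c < (\<integral>f. F f \<partial>\<nu>)"
  then show "eventually (\<lambda>u. c < rate b u * (\<integral>w. F (vinv u \<odot> X w) \<partial>M)) to_infty"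
    by (rule RV_CT_liminf[OF K M X F n e supp cont])
next
  fix c assume "(\<integral>f. F f \<partial>\<nu>) < c"
  then have c: "- c < (\<integral>f. - F f \<partial>\<nu>)" by simp
  have "AE f in \<nu>. ((\<lambda>f. - F f) \<longlongrightarrow> - F f) (atin lu_topology f)"
    using cont by eventually_elim (rule tendsto_minus)
  then have "eventually (\<lambda>u. - c < rate b u * (\<integral>w. - F (vinv u \<odot> X w) \<partial>M)) to_infty"
    using F supp c by (intro RV_CT_liminf[OF K M X _ _ n e]) simp_all
  then show "eventually (\<lambda>u. rate b u * (\<integral>w. F (vinv u \<odot> X w) \<partial>M) < c) to_infty"
    by simp
qed

section \<open>The measure of a representer\<close>

lemma measurable_vec_nth_le [measurable]:
  "Measurable.pred borel (\<lambda>r :: real ^ 'q. c < r $ i)"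
proof -
  have [measurable]: "(\<lambda>r :: real ^ 'q. r $ i) \<in> borel_measurable borel"
    by (rule borel_measurable_nth)
  show ?thesis by measurable
qed

lemma sets_orthant: "{r :: real ^ 'q. \<forall>i. c i < r $ i} \<in> sets borel"
proof -
  have "{r \<in> space borel. \<forall>i. c i < (r :: real ^ 'q) $ i} \<in> sets borel" by measurable
  then show ?thesis by simp
qed

lemma sets_pos_vecs: "(pos_vecs :: (real ^ 'q) set) \<in> sets borel"
  using sets_orthant[of "\<lambda>_. 0"] by (simp add: pos_vecs_def)

lemma theta_density_measurable:
  "(\<lambda>r. ennreal (\<Prod>i\<in>UNIV. \<alpha> $ i * (r $ i) powr (- (\<alpha> $ i) - 1)) * indicator pos_vecs r)
     \<in> borel_measurable (lborel :: (real ^ 'q) measure)"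
proof -
  have [measurable]: "(\<lambda>r :: real ^ 'q. r $ i) \<in> borel_measurable lborel" for i
    using borel_measurable_nth by simp
  have [measurable]: "pos_vecs \<in> sets (lborel :: (real ^ 'q) measure)"
    using sets_pos_vecs by simp
  show ?thesis by measurable
qed

lemma sets_theta: "sets (theta \<alpha>) = sets borel"
  by (simp add: theta_def)

lemma AE_theta_pos_vecs: "AE r in theta \<alpha>. r \<in> pos_vecs"
  unfolding theta_def AE_density[OF theta_density_measurable]
  by (auto simp: indicator_def)

lemma AE_theta_nth_neq:
  fixes \<alpha> :: "real ^ 'q"
  shows "AE r in theta \<alpha>. r $ i \<noteq> c"
proof -
  have "{r :: real ^ 'q. r $ i = c} \<in> sets lborel"
    using measurable_sets[OF borel_measurable_nth[of i], of "{c}"] by (simp add: vimage_def)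
  moreover have "negligible {r :: real ^ 'q. r $ i = c}"
    using negligible_standard_hyperplane[of "axis i (1::real)" c]
    by (auto simp: cart_eq_inner_axis Basis_vec_def)
  ultimately have "{r :: real ^ 'q. r $ i = c} \<in> null_sets lborel"
    by (simp add: negligible_iff_null_sets null_sets_completion_iff)
  then have "AE r in lborel. (r :: real ^ 'q) $ i \<noteq> c"
    using AE_not_in by fastforce
  then show ?thesis
    unfolding theta_def AE_density[OF theta_density_measurable] by eventually_elim simp
qed

section \<open>Power tails and orthants under \<open>theta\<close>\<close>

lemma nn_integral_powr_tail:
  fixes a c :: real
  assumes "a > 0" "c > 0"
  shows "(\<integral>\<^sup>+ x. ennreal (a * x powr (- a - 1)) * indicator {c<..} x \<partial>lborel) = ennreal (c powr (- a))"
proof -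
  \<comment> \<open>Orthants are open, whereas the fundamental theorem is applied on a closed
    half-line; the endpoint is a null set.\<close>
  have "(\<integral>\<^sup>+ x. ennreal (a * x powr (- a - 1)) * indicator {c<..} x \<partial>lborel)
      = (\<integral>\<^sup>+ x. ennreal (a * x powr (- a - 1)) * indicator {c..} x \<partial>lborel)"
    using AE_lborel_singleton[of c]
    by (intro nn_integral_cong_AE) (auto elim!: eventually_mono simp: indicator_def)
  also have "\<dots> = ennreal (0 - (- (c powr (- a))))"
  proof (rule nn_integral_FTC_atLeast)
    show "((\<lambda>x. - (x powr (- a))) has_real_derivative a * x powr (- a - 1)) (at x)" if "c \<le> x" for x
    proof -
      have "x > 0" using that assms by linarith
      then show ?thesis by (auto intro!: derivative_eq_intros simp: powr_diff)
    qed
    have "((\<lambda>x. x powr (- a)) \<longlongrightarrow> 0) at_top"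
      using assms by (intro tendsto_neg_powr filterlim_ident) auto
    from tendsto_minus[OF this] show "((\<lambda>x. - (x powr (- a))) \<longlongrightarrow> 0) at_top" by simp
  qed (use assms in auto)
  finally show ?thesis by simp
qed

text \<open>This is Tonelli's product formula over the Euclidean basis, reindexed along
  \<open>axis i 1\<close>; \<open>k\<close> recovers the index from the basis vector.\<close>

lemma nn_integral_lborel_vec_prod:
  fixes g :: "'q::finite \<Rightarrow> real \<Rightarrow> ennreal"
  assumes g: "\<And>i. g i \<in> borel_measurable borel"
  shows "(\<integral>\<^sup>+ x. (\<Prod>i\<in>UNIV. g i ((x :: real ^ 'q) $ i)) \<partial>lborel) = (\<Prod>i\<in>UNIV. \<integral>\<^sup>+ x. g i x \<partial>lborel)"
proof -
  let ?ax = "\<lambda>i :: 'q. axis i (1 :: real)"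
  define k where "k b = inv ?ax b" for b
  have inj: "inj ?ax" by (auto simp: inj_def axis_eq_axis)
  have k: "k (?ax i) = i" for i unfolding k_def by (rule inv_f_f[OF inj])
  have B: "(Basis :: (real ^ 'q) set) = range ?ax" by (auto simp: Basis_vec_def)
  have "(\<integral>\<^sup>+ x. (\<Prod>b\<in>Basis. g (k b) ((x :: real ^ 'q) \<bullet> b)) \<partial>lborel) = (\<Prod>b\<in>(Basis :: (real ^ 'q) set). \<integral>\<^sup>+ x. g (k b) x \<partial>lborel)"
    by (rule nn_integral_lborel_prod) (use g in auto)
  then show ?thesis
    by (simp add: B prod.reindex[OF inj] k inner_axis)
qed

text \<open>Positive thresholds place the orthant inside \<open>pos_vecs\<close>, so density and
  both indicators together factor into one-dimensional tails.\<close>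

lemma emeasure_theta_orthant:
  fixes \<alpha> :: "real ^ 'q"
  assumes \<alpha>: "\<alpha> \<in> pos_vecs" and c: "\<And>i. c i > 0"
  shows "emeasure (theta \<alpha>) {r. \<forall>i. c i < r $ i} = ennreal (\<Prod>i\<in>UNIV. c i powr (- (\<alpha> $ i)))"
proof -
  have \<alpha>0: "\<alpha> $ i > 0" for i using \<alpha> by (simp add: pos_vecs_def)
  let ?g = "\<lambda>i x. ennreal (\<alpha> $ i * x powr (- (\<alpha> $ i) - 1)) * indicator {c i<..} x"
  have "emeasure (theta \<alpha>) {r. \<forall>i. c i < r $ i} =
      (\<integral>\<^sup>+ r. ennreal (\<Prod>i\<in>UNIV. \<alpha> $ i * (r $ i) powr (- (\<alpha> $ i) - 1)) * indicator pos_vecs r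
          * indicator {r. \<forall>i. c i < r $ i} r \<partial>lborel)"
    unfolding theta_def using sets_orthant by (intro emeasure_density theta_density_measurable) simp
  also have "\<dots> = (\<integral>\<^sup>+ r. (\<Prod>i\<in>UNIV. ?g i (r $ i)) \<partial>lborel)"
  proof (rule nn_integral_cong)
    fix r :: "real ^ 'q"
    show "ennreal (\<Prod>i\<in>UNIV. \<alpha> $ i * (r $ i) powr (- (\<alpha> $ i) - 1)) * indicator pos_vecs r
          * indicator {r. \<forall>i. c i < r $ i} r = (\<Prod>i\<in>UNIV. ?g i (r $ i))"
    proof (cases "\<forall>i. c i < r $ i")
      case True
      then have "r \<in> pos_vecs" using c by (auto simp: pos_vecs_def intro: less_trans)
      then show ?thesis using True \<alpha>0 by (simp add: prod_ennreal less_imp_le)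
    next
      case False
      then obtain i where "\<not> c i < r $ i" by blast
      then have "(\<Prod>i\<in>UNIV. ?g i (r $ i)) = 0"
        by (intro prod_zero bexI[of _ i]) auto
      moreover have "indicator {r. \<forall>i. c i < r $ i} r = (0 :: ennreal)"
        using False by (intro indicator_simps(2)) blast
      ultimately show ?thesis by (simp only: mult_zero_right)
    qed
  qed
  also have "\<dots> = (\<Prod>i\<in>UNIV. \<integral>\<^sup>+ x. ?g i x \<partial>lborel)"
    by (rule nn_integral_lborel_vec_prod) measurable
  also have "\<dots> = (\<Prod>i\<in>UNIV. ennreal (c i powr (- (\<alpha> $ i))))"
    using nn_integral_powr_tail[OF \<alpha>0 c] by simp
  also have "\<dots> = ennreal (\<Prod>i\<in>UNIV. c i powr (- (\<alpha> $ i)))"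
    by (simp add: prod_ennreal)
  finally show ?thesis .
qed

section \<open>From \<open>theta\<close> to the measure on paths\<close>

lemma CPi_subset_CT: "CPi \<subseteq> CT"
  by (auto simp: CPi_def)

lemma space_borel_CPi: "space borel_CPi = CPi"
  using CPi_subset_CT by (auto simp: borel_CPi_def space_restrict_space space_borel_CT)

lemma sets_borel_CPiI: "A \<in> sets borel_CT \<Longrightarrow> A \<subseteq> CPi \<Longrightarrow> A \<in> sets borel_CPi"
  by (auto simp: borel_CPi_def sets_restrict_space intro!: image_eqI[of _ _ A])

lemma measurable_borel_CT_imp_borel_CPi:
  "F \<in> borel_CT \<rightarrow>\<^sub>M N \<Longrightarrow> F \<in> borel_CPi \<rightarrow>\<^sub>M N"
  unfolding borel_CPi_def by (rule measurable_restrict_space1)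

lemma scale_fun_in_CPi:
  assumes "r \<in> pos_vecs" "f \<in> CPi"
  shows "r \<odot> f \<in> CPi"
proof -
  have "\<exists>t. (r \<odot> f) t $ i \<noteq> 0" for i
  proof -
    obtain t where "f t $ i \<noteq> 0" using assms(2) by (auto simp: CPi_def)
    moreover have "r $ i > 0" using assms(1) by (simp add: pos_vecs_def)
    ultimately show ?thesis by (intro exI[of _ t]) (auto simp: scale_fun_def)
  qed
  then show ?thesis using assms(2) scale_fun_in_CT by (auto simp: CPi_def)
qed

text \<open>
  If the set function defining \<open>nu_of\<close> were not countably additive, \<open>measure_of\<close> would return the
  zero measure.  Nontriviality therefore yields the formula without proving joint measurability of
  the scaling action.
\<close>

lemma emeasure_nu_of:
  assumes nz: "\<exists>B. emeasure (nu_of \<alpha> N Z) B \<noteq> 0" and A: "A \<in> sets borel_CPi"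
  shows "emeasure (nu_of \<alpha> N Z) A = (\<integral>\<^sup>+ w. (\<integral>\<^sup>+ r. indicator A (r \<odot> Z w) \<partial>theta \<alpha>) \<partial>N)"
proof -
  have "sigma_sets CPi (sets borel_CPi) = sets borel_CPi"
    using sets.sigma_sets_eq[of borel_CPi] by (simp add: space_borel_CPi)
  then show ?thesis
    using nz A unfolding nu_of_def emeasure_measure_of_conv by (auto split: if_splits)
qed

context
  fixes \<alpha> :: "real ^ 'q" and N :: "'z measure" and Z :: "'z \<Rightarrow> 't::topological_space \<Rightarrow> real ^ 'q"
    and H :: "('t \<Rightarrow> real ^ 'q) \<Rightarrow> real ^ 'q"
  assumes \<alpha>: "\<alpha> \<in> pos_vecs" and Z: "Z \<in> N \<rightarrow>\<^sub>M borel_CPi"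
    and nz: "\<exists>B. emeasure (nu_of \<alpha> N Z) B \<noteq> 0"
    and Hm: "H \<in> borel_CT \<rightarrow>\<^sub>M borel"
    and Hh: "\<forall>r\<in>pos_vecs. \<forall>f\<in>CT. H (r \<odot> f) = r * H f"
begin

lemma Z_in_CPi: "w \<in> space N \<Longrightarrow> Z w \<in> CPi"
  using measurable_space[OF Z] by (simp add: space_borel_CPi)

lemma H_nth_measurable: "(\<lambda>f. H f $ i) \<in> borel_measurable borel_CPi"
  by (rule measurable_compose[OF measurable_borel_CT_imp_borel_CPi[OF Hm] borel_measurable_nth])

text \<open>Along the orbit of \<open>Z w\<close> the condition reads
  \<open>r $ i * H (Z w) $ i = c\<close>, which fixes \<open>r $ i\<close> if
  \<open>H (Z w) $ i\<close> is nonzero and is impossible otherwise, because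
  \<open>c \<noteq> 0\<close>. For \<open>c = 0\<close> a whole orbit could lie in the set.\<close>

lemma emeasure_nu_of_hyperplane:
  assumes "c \<noteq> 0"
  shows "emeasure (nu_of \<alpha> N Z) {f\<in>CPi. H f $ i = c} = 0"
proof -
  let ?A = "{f\<in>CPi. H f $ i = c}"
  have "?A = (\<lambda>f. H f $ i) -` {c} \<inter> space borel_CPi" by (auto simp: space_borel_CPi)
  then have A: "?A \<in> sets borel_CPi" using measurable_sets[OF H_nth_measurable] by simp
  have "(\<integral>\<^sup>+ r. indicator ?A (r \<odot> Z w) \<partial>theta \<alpha>) = 0" if w: "w \<in> space N" for w
  proof -
    have "AE r in theta \<alpha>. r \<odot> Z w \<notin> ?A"
      using AE_theta_pos_vecs AE_theta_nth_neq[where \<alpha> = \<alpha> and i = i and c = "c / H (Z w) $ i"]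
    proof eventually_elim
      case (elim r)
      have "H (r \<odot> Z w) $ i = r $ i * H (Z w) $ i"
        using Hh elim(1) Z_in_CPi[OF w] CPi_subset_CT by (auto simp: subset_iff)
      then show ?case using elim(2) assms by (auto simp: field_simps)
    qed
    then have "(\<integral>\<^sup>+ r. indicator ?A (r \<odot> Z w) \<partial>theta \<alpha>) = (\<integral>\<^sup>+ r. 0 \<partial>theta \<alpha>)"
      by (intro nn_integral_cong_AE) (auto elim!: eventually_mono simp: indicator_def)
    then show ?thesis by simp
  qed
  then have "(\<integral>\<^sup>+ w. (\<integral>\<^sup>+ r. indicator ?A (r \<odot> Z w) \<partial>theta \<alpha>) \<partial>N) = 0"
    by (simp cong: nn_integral_cong)
  then show ?thesis using emeasure_nu_of[OF nz A] by simp
qed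

text \<open>If all coordinates of \<open>H f\<close> are positive, the admissible \<open>r\<close>
  form the orthant with corner \<open>x $ i / H f $ i\<close>, whose mass is explicit. If one
  coordinate is 0, no rescaling reaches the orthant and both sides vanish.\<close>

lemma nn_integral_theta_H_orthant:
  assumes f: "f \<in> CPi" and x: "x \<in> pos_vecs" and h: "\<And>i. 0 \<le> H f $ i"
  shows "(\<integral>\<^sup>+ r. indicator {g\<in>CPi. \<forall>i. x $ i < H g $ i} (r \<odot> f) \<partial>theta \<alpha>)
    = ennreal (\<Prod>i\<in>UNIV. x $ i powr (- (\<alpha> $ i))) * ennreal (\<Prod>i\<in>UNIV. H f $ i powr (\<alpha> $ i))"
proof -
  let ?A = "{g\<in>CPi. \<forall>i. x $ i < H g $ i}"
  have x0: "x $ i > 0" for i using x by (simp add: pos_vecs_def)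
  have Hr: "H (r \<odot> f) = r * H f" if "r \<in> pos_vecs" for r
    using Hh that f CPi_subset_CT by blast
  show ?thesis
  proof (cases "\<forall>i. 0 < H f $ i")
    case True
    have "AE r in theta \<alpha>. indicator ?A (r \<odot> f) = (indicator {r. \<forall>i. x $ i / H f $ i < r $ i} r :: ennreal)"
      using AE_theta_pos_vecs
      by eventually_elim (use True f in \<open>auto simp: indicator_def Hr scale_fun_in_CPi divide_less_eq\<close>)
    then have "(\<integral>\<^sup>+ r. indicator ?A (r \<odot> f) \<partial>theta \<alpha>)
        = emeasure (theta \<alpha>) {r. \<forall>i. x $ i / H f $ i < r $ i}"
      using sets_orthant[of "\<lambda>i. x $ i / H f $ i"]
      by (simp add: nn_integral_cong_AE nn_integral_indicator sets_theta)
    also have "\<dots> = ennreal (\<Prod>i\<in>UNIV. (x $ i / H f $ i) powr (- (\<alpha> $ i)))"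
      using True x0 by (intro emeasure_theta_orthant \<alpha>) simp
    also have "(\<Prod>i\<in>UNIV. (x $ i / H f $ i) powr (- (\<alpha> $ i)))
        = (\<Prod>i\<in>UNIV. x $ i powr (- (\<alpha> $ i))) * (\<Prod>i\<in>UNIV. H f $ i powr (\<alpha> $ i))"
      using True x0
      by (simp flip: prod.distrib add: powr_divide powr_minus less_imp_le field_simps)
    finally show ?thesis by (simp add: ennreal_mult prod_nonneg)
  next
    case False
    then obtain i where i: "H f $ i = 0" using h by (metis less_le)
    have "AE r in theta \<alpha>. r \<odot> f \<notin> ?A"
      using AE_theta_pos_vecs
    proof eventually_elim
      case (elim r)
      have "H (r \<odot> f) $ i = 0" using Hr[OF elim] i by simp
      then have "\<not> x $ i < H (r \<odot> f) $ i" using x0[of i] by simp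
      then show ?case by blast
    qed
    then have "(\<integral>\<^sup>+ r. indicator ?A (r \<odot> f) \<partial>theta \<alpha>) = (\<integral>\<^sup>+ r. 0 \<partial>theta \<alpha>)"
      by (intro nn_integral_cong_AE) (auto elim!: eventually_mono simp: indicator_def)
    \<comment> \<open>The convention \<open>0 powr a = 0\<close> makes the formula valid in the
      degenerate case too.\<close>
    moreover have "(\<Prod>i\<in>UNIV. H f $ i powr (\<alpha> $ i)) = 0"
      using i by (intro prod_zero) auto
    ultimately show ?thesis by (simp del: prod_zero_iff)
  qed
qed

text \<open>The factor in \<open>x\<close> is deterministic and leaves the expectation; setting
  \<open>x = 1\<close> later identifies the remaining factor as the mass of the exceedance
  set.\<close>

lemma emeasure_nu_of_H_orthant:
  assumes x: "x \<in> pos_vecs" and h: "\<forall>f\<in>CT. \<forall>i. 0 \<le> H f $ i"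
  shows "emeasure (nu_of \<alpha> N Z) {f\<in>CPi. \<forall>i. x $ i < H f $ i}
    = ennreal (\<Prod>i\<in>UNIV. x $ i powr (- (\<alpha> $ i))) *
      (\<integral>\<^sup>+ w. ennreal (\<Prod>i\<in>UNIV. H (Z w) $ i powr (\<alpha> $ i)) \<partial>N)"
proof -
  let ?A = "{f\<in>CPi. \<forall>i. x $ i < H f $ i}"
  note [measurable] = H_nth_measurable
  have "{f\<in>space borel_CPi. \<forall>i. x $ i < H f $ i} \<in> sets borel_CPi" by measurable
  then have A: "?A \<in> sets borel_CPi" by (simp add: space_borel_CPi)
  have [measurable]: "(\<lambda>w. H (Z w) $ i) \<in> borel_measurable N" for i
    by (rule measurable_compose[OF Z H_nth_measurable])
  have "emeasure (nu_of \<alpha> N Z) ?A = (\<integral>\<^sup>+ w. (\<integral>\<^sup>+ r. indicator ?A (r \<odot> Z w) \<partial>theta \<alpha>) \<partial>N)"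
    by (rule emeasure_nu_of[OF nz A])
  also have "\<dots> = (\<integral>\<^sup>+ w. ennreal (\<Prod>i\<in>UNIV. x $ i powr (- (\<alpha> $ i))) *
      ennreal (\<Prod>i\<in>UNIV. H (Z w) $ i powr (\<alpha> $ i)) \<partial>N)"
    using h Z_in_CPi CPi_subset_CT
    by (intro nn_integral_cong nn_integral_theta_H_orthant x) (auto simp: subset_iff)
  also have "\<dots> = ennreal (\<Prod>i\<in>UNIV. x $ i powr (- (\<alpha> $ i))) *
      (\<integral>\<^sup>+ w. ennreal (\<Prod>i\<in>UNIV. H (Z w) $ i powr (\<alpha> $ i)) \<partial>N)"
    by (rule nn_integral_cmult) measurable
  finally show ?thesis .
qed

end

section \<open>Homogeneous maps\<close>

text \<open>Dividing \<open>f\<close> by \<open>x\<close> lands in the exceedance set, hence in the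
  given window; multiplying a witness point's value back by \<open>x\<close> rescales the thresholds
  and leaves the compact sets \<open>K (n i)\<close> unchanged.\<close>

lemma exceedance_subset_window:
  assumes K: "compact_exhaustion K" and n: "\<forall>i. n i \<ge> 1"
    and Hh: "\<forall>r\<in>pos_vecs. \<forall>f\<in>CT. H (r \<odot> f) = r * H f"
    and A: "exceedance_set H \<subseteq> window K n \<delta>"
    and f: "f \<in> CT" and x: "x \<in> pos_vecs" and fx: "\<And>i. x $ i < \<bar>H f $ i\<bar>"
  shows "f \<in> window K n (x * \<delta>)"
proof -
  have x0: "x $ i > 0" for i using x by (simp add: pos_vecs_def)
  let ?g = "vinv x \<odot> f"
  have g: "?g \<in> CT" by (rule scale_fun_in_CT[OF f])
  have "\<bar>H ?g $ i\<bar> > 1" for i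
    using Hh vinv_pos_vecs[OF x] f fx[of i] x0[of i]
    by (simp add: vinv_def abs_mult field_simps)
  then have gw: "?g \<in> window K n \<delta>" using A g by (auto simp: exceedance_set_def)
  have "rho K (n i) i f > (x * \<delta>) $ i" for i
  proof -
    note KK = compact_exhaustion_props[OF K n[rule_format, of i]]
    obtain t where t: "t \<in> K (n i)" "\<delta> $ i < \<bar>?g t $ i\<bar>"
      using gw less_rho_iff[of K "n i" ?g "\<delta> $ i" i] KK g by (auto simp: window_def)
    then have "(x * \<delta>) $ i < \<bar>f t $ i\<bar>"
      using x0[of i] by (simp add: scale_fun_def vinv_def abs_mult field_simps)
    then show ?thesis using t less_rho_iff[of K "n i" f "(x * \<delta>) $ i" i] KK f by blast
  qed
  then show ?thesis using f by (simp add: window_def)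
qed

lemma mult_pos_vecs: "x \<in> pos_vecs \<Longrightarrow> y \<in> pos_vecs \<Longrightarrow> x * y \<in> pos_vecs"
  by (simp add: pos_vecs_def)

text \<open>The hypotheses on \<open>G\<close> are general enough for two uses: continuous test
  functions and indicators of orthants. The latter are discontinuous, so continuity is asked only at
  almost every value \<open>H f\<close>, and their corner is arbitrary, so the threshold
  \<open>x\<close> is a vector.\<close>

lemma RV_CT_mapping_tendsto:
  fixes K :: "nat \<Rightarrow> 't::topological_space set" and H :: "('t \<Rightarrow> real ^ 'q) \<Rightarrow> real ^ 'q"
    and G :: "real ^ 'q \<Rightarrow> real"
  assumes K: "compact_exhaustion K" and M: "prob_space M" and X: "RV_CT K \<alpha> \<nu> b M X"
    and Hm: "H \<in> borel_CT \<rightarrow>\<^sub>M borel"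
    and Hc: "AE f in \<nu>. continuous_at_CT H f"
    and Hh: "\<forall>r\<in>pos_vecs. \<forall>f\<in>CT. H (r \<odot> f) = r * H f"
    and A: "exceedance_set H \<in> BPi K"
    and G: "G \<in> borel_measurable borel" "\<And>y. \<bar>G y\<bar> \<le> C"
    and x: "x \<in> pos_vecs" and G0: "\<And>y i. \<bar>y $ i\<bar> \<le> x $ i \<Longrightarrow> G y = 0"
    and Gc: "AE f in \<nu>. isCont G (H f)"
  shows "((\<lambda>u. rate b u * (\<integral>w. G (vinv u * H (X w)) \<partial>M)) \<longlongrightarrow> (\<integral>f. G (H f) \<partial>\<nu>)) to_infty"
proof -
  obtain n \<delta> where n: "\<forall>i. n i \<ge> 1" and \<delta>: "\<delta> \<in> pos_vecs" and sub: "exceedance_set H \<subseteq> window K n \<delta>"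
    using A unfolding BPi_def by blast
  have Xm: "X \<in> M \<rightarrow>\<^sub>M borel_CT" using X by (simp add: RV_CT_def)
  have "((\<lambda>u. rate b u * (\<integral>w. G (H (vinv u \<odot> X w)) \<partial>M)) \<longlongrightarrow> (\<integral>f. G (H f) \<partial>\<nu>)) to_infty"
  proof (rule RV_CT_tendsto_AE_continuous[OF K M X _ _ n mult_pos_vecs[OF x \<delta>]])
    show "(\<lambda>f. G (H f)) \<in> borel_measurable borel_CT" by (rule measurable_compose[OF Hm G(1)])
    show "\<forall>f\<in>CT. \<bar>G (H f)\<bar> \<le> C" using G(2) by blast
    show "\<forall>f\<in>CT - window K n (x * \<delta>). G (H f) = 0"
    proof
      fix f assume f: "f \<in> CT - window K n (x * \<delta>)"
      then obtain i where "\<bar>H f $ i\<bar> \<le> x $ i"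
        using exceedance_subset_window[OF K n Hh sub _ x, of f] by (meson DiffE not_less)
      then show "G (H f) = 0" by (rule G0)
    qed
    show "AE f in \<nu>. ((\<lambda>f. G (H f)) \<longlongrightarrow> G (H f)) (atin lu_topology f)"
      using Hc Gc
      by eventually_elim (auto simp: continuous_at_CT_def intro: isCont_tendsto_compose)
  qed
  then show ?thesis
  proof (rule Lim_transform_eventually)
    show "eventually (\<lambda>u. rate b u * (\<integral>w. G (H (vinv u \<odot> X w)) \<partial>M)
        = rate b u * (\<integral>w. G (vinv u * H (X w)) \<partial>M)) to_infty"
      using eventually_to_infty_pos_vecs
    proof eventually_elim
      case (elim u)
      have "H (vinv u \<odot> X w) = vinv u * H (X w)" if "w \<in> space M" for w
        using Hh vinv_pos_vecs[OF elim] measurable_space[OF Xm that] by (simp add: space_borel_CT)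
      then have "(\<integral>w. G (H (vinv u \<odot> X w)) \<partial>M) = (\<integral>w. G (vinv u * H (X w)) \<partial>M)"
        by (intro Bochner_Integration.integral_cong) auto
      then show ?case by simp
    qed
  qed
qed

text \<open>Away from all the hyperplanes \<open>y $ i = x $ i\<close> the indicator is locally
  constant. This asks more than avoiding the boundary, but it matches the null sets
  available.\<close>

lemma isCont_indicator_orthant:
  fixes x y :: "real ^ 'q"
  assumes "\<And>i. y $ i \<noteq> x $ i"
  shows "isCont (indicator {y. \<forall>i. x $ i < y $ i} :: real ^ 'q \<Rightarrow> real) y"
proof (cases "\<forall>i. x $ i < y $ i")
  case True
  have "eventually (\<lambda>z. x $ i < z $ i) (nhds y)" for i
    using True by (intro order_tendstoD(1)[OF tendsto_vec_nth[OF filterlim_ident]]) auto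
  then have "eventually (\<lambda>z. \<forall>i. x $ i < z $ i) (nhds y)"
    by (simp add: eventually_all_finite)
  then have "eventually (\<lambda>z. indicator {y. \<forall>i. x $ i < y $ i} z = (1 :: real)) (nhds y)"
    by eventually_elim simp
  from isCont_cong[OF this] show ?thesis by simp
next
  case False
  then obtain i where "y $ i < x $ i" using assms by (metis not_less_iff_gr_or_eq)
  then have "eventually (\<lambda>z. z $ i < x $ i) (nhds y)"
    by (intro order_tendstoD(2)[OF tendsto_vec_nth[OF filterlim_ident]]) auto
  then have "eventually (\<lambda>z. indicator {y. \<forall>i. x $ i < y $ i} z = (0 :: real)) (nhds y)"
    by eventually_elim (auto simp: indicator_def intro: less_asym)
  from isCont_cong[OF this] show ?thesis by simp
qed

section \<open>The image measure off the coordinate hyperplanes\<close>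

lemma sets_nonzero_vecs: "(nonzero_vecs :: (real ^ 'q) set) \<in> sets borel"
proof -
  have [measurable]: "(\<lambda>r :: real ^ 'q. r $ i) \<in> borel_measurable borel" for i
    by (rule borel_measurable_nth)
  have "{r \<in> space borel. \<forall>i. (r :: real ^ 'q) $ i \<noteq> 0} \<in> sets borel" by measurable
  then show ?thesis by (simp add: nonzero_vecs_def)
qed

lemma emeasure_pushforward_nz:
  assumes "H \<in> \<nu> \<rightarrow>\<^sub>M borel" "B \<in> sets borel" "B \<subseteq> nonzero_vecs"
  shows "emeasure (pushforward_nz H \<nu>) B = emeasure \<nu> {f \<in> space \<nu>. H f \<in> B}"
proof -
  have "emeasure (pushforward_nz H \<nu>) B = emeasure (distr \<nu> borel H) B"
    unfolding pushforward_nz_def using assms sets_nonzero_vecs by (intro emeasure_restrict_space) auto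
  also have "\<dots> = emeasure \<nu> {f \<in> space \<nu>. H f \<in> B}"
    using assms by (simp add: emeasure_distr vimage_def Int_def conj_commute)
  finally show ?thesis .
qed

lemma integral_pushforward_nz:
  fixes F :: "real ^ 'q \<Rightarrow> real"
  assumes "H \<in> \<nu> \<rightarrow>\<^sub>M borel" "F \<in> borel_measurable borel" "\<And>x. x \<notin> nonzero_vecs \<Longrightarrow> F x = 0"
  shows "(\<integral>x. F x \<partial>pushforward_nz H \<nu>) = (\<integral>f. F (H f) \<partial>\<nu>)"
proof -
  have "(\<integral>x. F x \<partial>pushforward_nz H \<nu>) = (\<integral>x. indicator nonzero_vecs x *\<^sub>R F x \<partial>distr \<nu> borel H)"
    unfolding pushforward_nz_def using sets_nonzero_vecs by (intro integral_restrict_space) simp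
  also have "(\<lambda>x. indicator nonzero_vecs x *\<^sub>R F x) = F"
    using assms(3) by (intro ext) (auto simp: indicator_def)
  also have "(\<integral>x. F x \<partial>distr \<nu> borel H) = (\<integral>f. F (H f) \<partial>\<nu>)"
    by (rule integral_distr[OF assms(1,2)])
  finally show ?thesis .
qed

lemma RV_CT_measurable:
  assumes "RV_CT K \<alpha> \<nu> b M X" "H \<in> borel_CT \<rightarrow>\<^sub>M N"
  shows "H \<in> \<nu> \<rightarrow>\<^sub>M N"
proof -
  have "sets \<nu> = sets borel_CPi" using assms(1) by (simp add: RV_CT_def)
  then show ?thesis
    using measurable_borel_CT_imp_borel_CPi[OF assms(2)] by (simp cong: measurable_cong_sets)
qed

text \<open>Nontriviality holds because \<open>H\<close> sends the exceedance set into
  \<open>nonzero_vecs\<close>; finiteness holds because the preimage of a bounded set lies in a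
  rescaled window; the limit transfers because test functions vanish off
  \<open>nonzero_vecs\<close>, so restricting the image measure does not change their
  integrals.\<close>

lemma RV_CT_imp_RV_vec:
  fixes K :: "nat \<Rightarrow> 't::topological_space set" and H :: "('t \<Rightarrow> real ^ 'q) \<Rightarrow> real ^ 'q"
  assumes K: "compact_exhaustion K" and M: "prob_space M" and X: "RV_CT K \<alpha> \<nu> b M X"
    and Hm: "H \<in> borel_CT \<rightarrow>\<^sub>M borel"
    and Hc: "AE f in \<nu>. continuous_at_CT H f"
    and Hh: "\<forall>r\<in>pos_vecs. \<forall>f\<in>CT. H (r \<odot> f) = r * H f"
    and A: "exceedance_set H \<in> BPi K" and A_pos: "emeasure \<nu> (exceedance_set H) > 0"
  shows "RV_vec \<alpha> (pushforward_nz H \<nu>) b M (\<lambda>w. H (X w))"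
proof -
  have sp: "space \<nu> = CPi" and st: "sets \<nu> = sets borel_CPi"
    and rv: "\<forall>i. regularly_varying (b i) (\<alpha> $ i)" and Xm: "X \<in> M \<rightarrow>\<^sub>M borel_CT"
    and fin: "\<And>n \<epsilon>. \<forall>i. n i \<ge> 1 \<Longrightarrow> \<epsilon> \<in> pos_vecs \<Longrightarrow> emeasure \<nu> (window K n \<epsilon>) < \<infinity>"
    using X by (auto simp: RV_CT_def)
  have H\<nu>: "H \<in> \<nu> \<rightarrow>\<^sub>M borel" by (rule RV_CT_measurable[OF X Hm])
  obtain n \<delta> where n: "\<forall>i. n i \<ge> 1" and \<delta>: "\<delta> \<in> pos_vecs" and sub: "exceedance_set H \<subseteq> window K n \<delta>"
    using A unfolding BPi_def by blast
  have nonzero: "emeasure (pushforward_nz H \<nu>) nonzero_vecs \<noteq> 0"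
  proof -
    have "exceedance_set H \<subseteq> CPi" using sub window_subset_CPi[OF K n \<delta>] by blast
    moreover have "H f \<in> nonzero_vecs" if "f \<in> exceedance_set H" for f
    proof -
      have "1 < \<bar>H f $ i\<bar>" for i using that by (simp add: exceedance_set_def)
      then have "H f $ i \<noteq> 0" for i using zero_less_abs_iff less_trans[OF zero_less_one] by blast
      then show ?thesis by (simp add: nonzero_vecs_def)
    qed
    ultimately have "exceedance_set H \<subseteq> {f \<in> space \<nu>. H f \<in> nonzero_vecs}" by (auto simp: sp)
    then have "emeasure \<nu> (exceedance_set H) \<le> emeasure \<nu> {f \<in> space \<nu>. H f \<in> nonzero_vecs}"
      using measurable_sets[OF H\<nu> sets_nonzero_vecs]
      by (intro emeasure_mono) (simp_all add: vimage_def Int_def conj_commute)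
    then show ?thesis
      using A_pos emeasure_pushforward_nz[OF H\<nu> sets_nonzero_vecs] by auto
  qed
  have bounded: "emeasure (pushforward_nz H \<nu>) B < \<infinity>" if Bb: "B \<in> vec_bounded_sets" for B
  proof -
    obtain \<epsilon> where B: "B \<in> sets borel" and e: "\<epsilon> > 0"
      and Be: "B \<subseteq> {x. Min (range (\<lambda>i. \<bar>x $ i\<bar>)) > \<epsilon>}"
      using Bb unfolding vec_bounded_sets_def by blast
    have By: "\<epsilon> < \<bar>y $ i\<bar>" if "y \<in> B" for y i using Be that by auto
    have Bnz: "B \<subseteq> nonzero_vecs"
    proof
      fix y assume y: "y \<in> B"
      have "y $ i \<noteq> 0" for i using By[OF y, of i] e by auto
      then show "y \<in> nonzero_vecs" by (simp add: nonzero_vecs_def)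
    qed
    \<comment> \<open>The scalar threshold of a bounded set becomes a constant vector, the form in
      which windows are rescaled.\<close>
    define x :: "real ^ 'q" where "x = (\<chi> i. \<epsilon>)"
    have x: "x \<in> pos_vecs" using e by (simp add: x_def pos_vecs_def)
    let ?W = "window K n (x * \<delta>)"
    have x\<delta>: "x * \<delta> \<in> pos_vecs" by (rule mult_pos_vecs[OF x \<delta>])
    have "{f \<in> space \<nu>. H f \<in> B} \<subseteq> ?W"
      using CPi_subset_CT By
      by (auto simp: sp x_def intro!: exceedance_subset_window[OF K n Hh sub _ x, unfolded x_def])
    moreover have "?W \<in> sets \<nu>"
      unfolding st
      by (rule sets_borel_CPiI[OF window_mem_sets[OF K n] window_subset_CPi[OF K n x\<delta>]])
    ultimately have "emeasure \<nu> {f \<in> space \<nu>. H f \<in> B} \<le> emeasure \<nu> ?W" by (rule emeasure_mono)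
    also have "\<dots> < \<infinity>" by (rule fin[OF n x\<delta>])
    finally show ?thesis using emeasure_pushforward_nz[OF H\<nu> B Bnz] by simp
  qed
  have lim: "((\<lambda>u. rate b u * (\<integral>w. F (vinv u * H (X w)) \<partial>M)) \<longlongrightarrow> (\<integral>x. F x \<partial>pushforward_nz H \<nu>)) to_infty"
    if Ft: "F \<in> vec_test" for F
  proof -
    obtain \<epsilon> where cont: "continuous_on UNIV F" and "bounded (range F)" and e: "\<epsilon> > 0"
      and F0: "\<And>x. Min (range (\<lambda>i. \<bar>x $ i\<bar>)) \<le> \<epsilon> \<Longrightarrow> F x = 0"
      using Ft unfolding vec_test_def by blast
    then obtain C where C: "\<And>y. \<bar>F y\<bar> \<le> C" unfolding bounded_real by blast
    have F0': "F y = 0" if "\<bar>y $ i\<bar> \<le> \<epsilon>" for y i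
      using that by (intro F0) (auto simp: Min_le_iff)
    have Fm: "F \<in> borel_measurable borel" by (rule borel_measurable_continuous_onI[OF cont])
    have "F y = 0" if y: "y \<notin> nonzero_vecs" for y
    proof -
      obtain i where "y $ i = 0" using y by (auto simp: nonzero_vecs_def)
      then show ?thesis using e by (intro F0'[of _ i]) simp
    qed
    then have "(\<integral>x. F x \<partial>pushforward_nz H \<nu>) = (\<integral>f. F (H f) \<partial>\<nu>)"
      by (rule integral_pushforward_nz[OF H\<nu> Fm])
    moreover have "((\<lambda>u. rate b u * (\<integral>w. F (vinv u * H (X w)) \<partial>M)) \<longlongrightarrow> (\<integral>f. F (H f) \<partial>\<nu>)) to_infty"
    proof (rule RV_CT_mapping_tendsto[OF K M X Hm Hc Hh A Fm C, where x = "\<chi> i. \<epsilon>"])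
      show "(\<chi> i. \<epsilon>) \<in> (pos_vecs :: (real ^ 'q) set)" using e by (simp add: pos_vecs_def)
      show "F y = 0" if "\<bar>y $ i\<bar> \<le> (\<chi> i. \<epsilon>) $ i" for y i using that F0' by simp
      show "AE f in \<nu>. isCont F (H f)"
        using cont by (simp add: continuous_on_eq_continuous_at)
    qed
    ultimately show ?thesis by simp
  qed
  have "sets (pushforward_nz H \<nu>) = sets (restrict_space borel nonzero_vecs)"
    unfolding pushforward_nz_def by (rule sets_restrict_space_cong) simp
  then show ?thesis
    unfolding RV_vec_def
    using rv nonzero bounded lim measurable_compose[OF Xm Hm]
    by (auto simp: pushforward_nz_def space_restrict_space)
qed

theorem lemma3p9:
  fixes K :: "nat \<Rightarrow> 't::topological_space set"
    and \<alpha> :: "real ^ 'q"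
    and b :: "'q \<Rightarrow> real \<Rightarrow> real"
    and N :: "'z measure" and Z :: "'z \<Rightarrow> 't \<Rightarrow> real ^ 'q"
    and M :: "'a measure" and X :: "'a \<Rightarrow> 't \<Rightarrow> real ^ 'q"
    and \<nu> :: "('t \<Rightarrow> real ^ 'q) measure"
    and H :: "('t \<Rightarrow> real ^ 'q) \<Rightarrow> real ^ 'q"
  assumes K: "index_exhaustion K"
    and \<alpha>: "\<alpha> \<in> pos_vecs"
    and N: "prob_space N" and Z: "representer K \<alpha> N Z"
    and \<nu>: "\<nu> = nu_of \<alpha> N Z"
    and M: "prob_space M" and X: "RV_CT K \<alpha> \<nu> b M X"
    and H_measurable: "H \<in> borel_CT \<rightarrow>\<^sub>M borel"
    and H_continuous: "AE f in \<nu>. continuous_at_CT H f"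
    and H_homogeneous: "\<forall>r\<in>pos_vecs. \<forall>f\<in>CT. H (r \<odot> f) = r * H f"
    and A_bounded: "exceedance_set H \<in> BPi K"
    and A_pos: "emeasure \<nu> (exceedance_set H) > 0"
  shows "RV_vec \<alpha> (pushforward_nz H \<nu>) b M (\<lambda>w. H (X w)) \<and>
    ((\<forall>f\<in>CT. \<forall>i. 0 \<le> H f $ i) \<longrightarrow>
      emeasure \<nu> (exceedance_set H)
        = (\<integral>\<^sup>+ w. ennreal (\<Prod>i\<in>UNIV. (H (Z w) $ i) powr (\<alpha> $ i)) \<partial>N) \<and>
      (\<forall>x\<in>pos_vecs.
        ((\<lambda>u. rate b u * measure M {w \<in> space M. \<forall>i. H (X w) $ i > u $ i * x $ i})
          \<longlongrightarrow> measure \<nu> (exceedance_set H) * (\<Prod>i\<in>UNIV. (x $ i) powr (- (\<alpha> $ i)))) to_infty))"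
proof (intro conjI impI ballI)
  note Kc = index_exhaustion_imp_compact_exhaustion[OF K]
  show "RV_vec \<alpha> (pushforward_nz H \<nu>) b M (\<lambda>w. H (X w))"
    by (rule RV_CT_imp_RV_vec[OF Kc M X H_measurable H_continuous H_homogeneous A_bounded A_pos])
  assume H_nonneg: "\<forall>f\<in>CT. \<forall>i. 0 \<le> H f $ i"
  have Zm: "Z \<in> N \<rightarrow>\<^sub>M borel_CPi" using Z by (simp add: representer_def)
  \<comment> \<open>Positive mass of the exceedance set excludes the zero measure that
    \<open>measure_of\<close> yields by default, so the integral formula for \<open>nu_of\<close>
    applies.\<close>
  have nz: "\<exists>B. emeasure (nu_of \<alpha> N Z) B \<noteq> 0" using A_pos unfolding \<nu> by (metis less_irrefl)
  have sp: "space \<nu> = CPi" and st: "sets \<nu> = sets borel_CPi" and Xm: "X \<in> M \<rightarrow>\<^sub>M borel_CT"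
    using X by (auto simp: RV_CT_def)
  define E where "E x = {f\<in>CPi. \<forall>i. x $ i < H f $ i}" for x
  note E_measure = emeasure_nu_of_H_orthant[OF \<alpha> Zm nz H_measurable H_homogeneous _ H_nonneg,
      folded \<nu> E_def]
  \<comment> \<open>Nonnegativity removes the absolute values, and membership in
    \<open>BPi K\<close> puts the exceedance set inside \<open>CPi\<close>. Here \<open>1\<close> is
    the vector with all entries 1.\<close>
  have A_E: "exceedance_set H = E 1"
  proof -
    have "exceedance_set H \<subseteq> CPi"
      using A_bounded sets.sets_into_space[of _ borel_CPi] by (auto simp: BPi_def space_borel_CPi)
    then show ?thesis
      using H_nonneg CPi_subset_CT by (fastforce simp: exceedance_set_def E_def)
  qed
  have one: "1 \<in> (pos_vecs :: (real ^ 'q) set)" by (simp add: pos_vecs_def)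
  show p: "emeasure \<nu> (exceedance_set H)
      = (\<integral>\<^sup>+ w. ennreal (\<Prod>i\<in>UNIV. (H (Z w) $ i) powr (\<alpha> $ i)) \<partial>N)"
    using E_measure[OF one] by (simp add: A_E)
  fix x :: "real ^ 'q" assume x: "x \<in> pos_vecs"
  have x0: "x $ i > 0" for i using x by (simp add: pos_vecs_def)
  let ?O = "{y :: real ^ 'q. \<forall>i. x $ i < y $ i}"
  \<comment> \<open>By \<open>p\<close>, the expectation occurring in \<open>E_measure\<close> is
    the exceedance mass itself.\<close>
  have "measure \<nu> (E x) = measure \<nu> (exceedance_set H) * (\<Prod>i\<in>UNIV. (x $ i) powr (- (\<alpha> $ i)))"
    unfolding measure_def E_measure[OF x] p[symmetric] by (simp add: enn2real_mult prod_nonneg)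
  moreover have "measure \<nu> (E x) = (\<integral>f. indicator ?O (H f) \<partial>\<nu>)"
  proof -
    have "(\<integral>f. indicator ?O (H f) \<partial>\<nu>) = (\<integral>f. indicator (E x) f \<partial>\<nu> :: real)"
      by (intro Bochner_Integration.integral_cong) (auto simp: E_def sp indicator_def)
    also have "\<dots> = measure \<nu> (E x \<inter> space \<nu>)" by (rule Bochner_Integration.integral_indicator)
    also have "E x \<inter> space \<nu> = E x" by (auto simp: sp E_def)
    finally show ?thesis by (rule sym)
  qed
  ultimately have limit: "(\<integral>f. indicator ?O (H f) \<partial>\<nu>)
      = measure \<nu> (exceedance_set H) * (\<Prod>i\<in>UNIV. (x $ i) powr (- (\<alpha> $ i)))"
    by simp
  \<comment> \<open>The corner \<open>x\<close> doubles as the threshold vector: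
    \<open>\<bar>y $ i\<bar> \<le> x $ i\<close> in one coordinate already excludes \<open>y\<close>
    from the orthant.\<close>
  have conv: "((\<lambda>u. rate b u * (\<integral>w. indicator ?O (vinv u * H (X w)) \<partial>M))
      \<longlongrightarrow> (\<integral>f. indicator ?O (H f) \<partial>\<nu>)) to_infty"
  proof (rule RV_CT_mapping_tendsto[OF Kc M X H_measurable H_continuous H_homogeneous A_bounded _ _ x,
        where C = 1])
    show "indicator ?O \<in> borel_measurable borel"
      using sets_orthant by (rule borel_measurable_indicator)
    show "\<bar>indicator ?O y\<bar> \<le> (1 :: real)" for y by (simp add: indicator_def)
    show "indicator ?O y = (0 :: real)" if "\<bar>y $ i\<bar> \<le> x $ i" for y i
    proof -
      have "\<not> x $ i < y $ i" using that by linarith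
      then show ?thesis by (auto simp: indicator_def)
    qed
    \<comment> \<open>Positivity of \<open>x $ i\<close> keeps the hyperplane away from 0, as its
      nullity requires; there are finitely many coordinates to combine.\<close>
    have "AE f in \<nu>. H f $ i \<noteq> x $ i" for i
    proof (rule AE_I)
      note Hi = measurable_compose[OF RV_CT_measurable[OF X H_measurable] borel_measurable_nth]
      show "{f \<in> space \<nu>. \<not> H f $ i \<noteq> x $ i} \<subseteq> {f \<in> CPi. H f $ i = x $ i}" by (auto simp: sp)
      show "emeasure \<nu> {f \<in> CPi. H f $ i = x $ i} = 0"
        unfolding \<nu> using x0[of i]
        by (intro emeasure_nu_of_hyperplane[OF \<alpha> Zm nz H_measurable H_homogeneous]) simp
      show "{f \<in> CPi. H f $ i = x $ i} \<in> sets \<nu>"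
        using measurable_sets[OF Hi, of "{x $ i}" i] by (simp add: sp vimage_def Int_def conj_commute)
    qed
    then have "AE f in \<nu>. \<forall>i. H f $ i \<noteq> x $ i" by (simp add: AE_all_countable)
    then show "AE f in \<nu>. isCont (indicator ?O :: _ \<Rightarrow> real) (H f)"
      by eventually_elim (simp add: isCont_indicator_orthant)
  qed
  \<comment> \<open>For positive \<open>u\<close> the rescaled orthant event is the joint exceedance
    event, so the expected indicator is its probability.\<close>
  have prob: "eventually (\<lambda>u. rate b u * (\<integral>w. indicator ?O (vinv u * H (X w)) \<partial>M)
      = rate b u * measure M {w \<in> space M. \<forall>i. H (X w) $ i > u $ i * x $ i}) to_infty"
    using eventually_to_infty_pos_vecs
  proof eventually_elim
    case (elim u)
    have "x $ i < inverse (u $ i) * y \<longleftrightarrow> u $ i * x $ i < y" for i y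
      using elim by (simp add: pos_vecs_def field_simps)
    then have "(\<integral>w. indicator ?O (vinv u * H (X w)) \<partial>M)
        = (\<integral>w. indicator {w \<in> space M. \<forall>i. H (X w) $ i > u $ i * x $ i} w \<partial>M :: real)"
      by (intro Bochner_Integration.integral_cong) (auto simp: indicator_def vinv_def)
    also have "\<dots> = measure M ({w \<in> space M. \<forall>i. H (X w) $ i > u $ i * x $ i} \<inter> space M)"
      by (rule Bochner_Integration.integral_indicator)
    also have "{w \<in> space M. \<forall>i. H (X w) $ i > u $ i * x $ i} \<inter> space M
        = {w \<in> space M. \<forall>i. H (X w) $ i > u $ i * x $ i}" by blast
    finally show ?case by (rule arg_cong)
  qed
  show "((\<lambda>u. rate b u * measure M {w \<in> space M. \<forall>i. H (X w) $ i > u $ i * x $ i})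
      \<longlongrightarrow> measure \<nu> (exceedance_set H) * (\<Prod>i\<in>UNIV. (x $ i) powr (- (\<alpha> $ i)))) to_infty"
    using Lim_transform_eventually[OF conv prob] by (simp only: limit)
qed

end
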